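(* The problems $\beta$-$\textsc{Unfrozenness}$ and $\alpha$-$\textsc{Unfrozenness}$ are in $\mathrm{P}$ for co-graphs; that is, there are deterministic polynomial-time algorithms that, given any co-graph $G$, decide whether $G$ is $\beta$-unfrozen and whether $G$ is $\alpha$-unfrozen, respectively.
   Context: Graphs are finite, undirected, simple, without loops. Co-graphs are defined recursively: a single-vertex graph $(\{v\},\emptyset)$ is a co-graph; if $G_1$ and $G_2$ are (vertex-disjoint) co-graphs, then so are their disjoint union $G_1\cup G_2$ and their join $G_1+G_2$ (the disjoint union together with all edges between $V(G_1)$ and $V(G_2)$). $\alpha(G)$ is the size of a maximum independent set and $\beta(G)$ the size of a minimum vertex cover. A nonedge of $G$ is a pair $e=\{u,v\}$ of distinct vertices with $e\notin E(G)$; for a nonedge $e$, $G+e$ is $G$ with $e$ added as an edge. For a parameter $\xi$, $G$ is $\xi$-unfrozen if $\xi(G+e)=\xi(G)$ for every nonedge $e$ of $G$; $\xi$-$\textsc{Unfrozenness}$ is the set of $\xi$-unfrozen graphs. Running time is polynomial in the size of the encoding of $G$. *)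

theory Defs
  imports Main "HOL-Computational_Algebra.Polynomial"
begin

type_synonym 'a ugraph = "'a set \<times> 'a set set"

abbreviation verts :: "'a ugraph \<Rightarrow> 'a set" where
  "verts G \<equiv> fst G"

abbreviation edges :: "'a ugraph \<Rightarrow> 'a set set" where
  "edges G \<equiv> snd G"

definition simple_graph :: "'a ugraph \<Rightarrow> bool" where
  "simple_graph G \<longleftrightarrow> finite (verts G) \<and> (\<forall>e\<in>edges G. e \<subseteq> verts G \<and> card e = 2)"

definition graph_union :: "'a ugraph \<Rightarrow> 'a ugraph \<Rightarrow> 'a ugraph" where
  "graph_union G H = (verts G \<union> verts H, edges G \<union> edges H)"

definition graph_join :: "'a ugraph \<Rightarrow> 'a ugraph \<Rightarrow> 'a ugraph" where
  "graph_join G H =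
     (verts G \<union> verts H, edges G \<union> edges H \<union> {{u, v} | u v. u \<in> verts G \<and> v \<in> verts H})"

inductive cograph :: "'a ugraph \<Rightarrow> bool" where
  single: "cograph ({v}, {})"
| union: "cograph G \<Longrightarrow> cograph H \<Longrightarrow> verts G \<inter> verts H = {} \<Longrightarrow> cograph (graph_union G H)"
| join: "cograph G \<Longrightarrow> cograph H \<Longrightarrow> verts G \<inter> verts H = {} \<Longrightarrow> cograph (graph_join G H)"

lemma cograph_simple_graph: "cograph G \<Longrightarrow> simple_graph G"
proof (induction rule: cograph.induct)
  case (single v)
  then show ?case by (simp add: simple_graph_def)
next
  case (union G H)
  then show ?case by (auto simp: simple_graph_def graph_union_def)
next
  case (join G H)
  then have "card {u, v} = 2" if "u \<in> verts G" "v \<in> verts H" for u v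
    using that by (metis card_2_iff disjoint_iff)
  with join show ?case by (fastforce simp: simple_graph_def graph_join_def)
qed

definition independent_set :: "'a ugraph \<Rightarrow> 'a set \<Rightarrow> bool" where
  "independent_set G S \<longleftrightarrow> S \<subseteq> verts G \<and> (\<forall>e\<in>edges G. \<not> e \<subseteq> S)"

definition vertex_cover :: "'a ugraph \<Rightarrow> 'a set \<Rightarrow> bool" where
  "vertex_cover G C \<longleftrightarrow> C \<subseteq> verts G \<and> (\<forall>e\<in>edges G. e \<inter> C \<noteq> {})"

definition alpha :: "'a ugraph \<Rightarrow> nat" where
  "alpha G = Max (card ` {S. independent_set G S})"

definition beta :: "'a ugraph \<Rightarrow> nat" where
  "beta G = Min (card ` {C. vertex_cover G C})"

definition nonedges :: "'a ugraph \<Rightarrow> 'a set set" where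
  "nonedges G = {{u, v} | u v. u \<in> verts G \<and> v \<in> verts G \<and> u \<noteq> v \<and> {u, v} \<notin> edges G}"

definition add_edge :: "'a ugraph \<Rightarrow> 'a set \<Rightarrow> 'a ugraph" where
  "add_edge G e = (verts G, insert e (edges G))"

definition unfrozen :: "('a ugraph \<Rightarrow> nat) \<Rightarrow> 'a ugraph \<Rightarrow> bool" where
  "unfrozen \<xi> G \<longleftrightarrow> (\<forall>e\<in>nonedges G. \<xi> (add_edge G e) = \<xi> G)"

definition unfrozenness :: "('a ugraph \<Rightarrow> nat) \<Rightarrow> 'a ugraph set" where
  "unfrozenness \<xi> = {G. simple_graph G \<and> unfrozen \<xi> G}"

datatype dir = Left | Stay | Right

text \<open>
  States and tape symbols are initial segments of the natural numbers. Symbol 0 is the blank,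
  symbols 1 and 2 are the input bits 0 and 1, and state 0 is the start state.
  Only the behaviour of \<open>delta\<close> on this finite range matters, see \<open>wf_tm\<close>.
\<close>

record tm =
  num_tapes :: nat
  num_states :: nat
  num_symbols :: nat
  acc_state :: nat
  rej_state :: nat
  delta :: "nat \<Rightarrow> nat list \<Rightarrow> nat \<times> (nat \<times> dir) list"

definition wf_tm :: "tm \<Rightarrow> bool" where
  "wf_tm M \<longleftrightarrow>
     1 \<le> num_tapes M \<and> 3 \<le> num_symbols M \<and> 0 < num_states M \<and>
     acc_state M < num_states M \<and> rej_state M < num_states M \<and> acc_state M \<noteq> rej_state M \<and>
     (\<forall>q ss. q < num_states M \<and> length ss = num_tapes M \<and> (\<forall>s\<in>set ss. s < num_symbols M) \<longrightarrow>
        (case delta M q ss of (q', acts) \<Rightarrow>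
           q' < num_states M \<and> length acts = num_tapes M \<and>
           (\<forall>(s, d)\<in>set acts. s < num_symbols M)))"

text \<open>A tape is two-way infinite, given by its head position and its contents.\<close>

type_synonym tape = "int \<times> (int \<Rightarrow> nat)"

type_synonym config = "nat \<times> tape list"

fun tape_read :: "tape \<Rightarrow> nat" where
  "tape_read (h, f) = f h"

fun move :: "dir \<Rightarrow> int \<Rightarrow> int" where
  "move Left h = h - 1"
| "move Stay h = h"
| "move Right h = h + 1"

fun tape_act :: "nat \<times> dir \<Rightarrow> tape \<Rightarrow> tape" where
  "tape_act (s, d) (h, f) = (move d h, f(h := s))"

definition halted :: "tm \<Rightarrow> config \<Rightarrow> bool" where
  "halted M c \<longleftrightarrow> fst c = acc_state M \<or> fst c = rej_state M"

definition tm_step :: "tm \<Rightarrow> config \<Rightarrow> config" where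
  "tm_step M c =
     (if halted M c then c
      else case delta M (fst c) (map tape_read (snd c)) of
        (q', acts) \<Rightarrow> (q', map2 tape_act acts (snd c)))"

definition blank_tape :: tape where
  "blank_tape = (0, \<lambda>_. 0)"

definition input_tape :: "bool list \<Rightarrow> tape" where
  "input_tape x =
     (0, \<lambda>i. if 0 \<le> i \<and> nat i < length x then (if x ! nat i then 2 else 1) else 0)"

definition tm_init :: "tm \<Rightarrow> bool list \<Rightarrow> config" where
  "tm_init M x = (0, input_tape x # replicate (num_tapes M - 1) blank_tape)"

definition tm_run :: "tm \<Rightarrow> bool list \<Rightarrow> nat \<Rightarrow> config" where
  "tm_run M x t = (tm_step M ^^ t) (tm_init M x)"

definition accepts :: "tm \<Rightarrow> bool list \<Rightarrow> bool" where
  "accepts M x \<longleftrightarrow> (\<exists>t. fst (tm_run M x t) = acc_state M)"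

definition polytime_tm :: "tm \<Rightarrow> bool" where
  "polytime_tm M \<longleftrightarrow>
     wf_tm M \<and> (\<exists>p :: nat poly. \<forall>x. halted M (tm_run M x (poly p (length x))))"

text \<open>
  The encoding of a graph along an enumeration \<open>vs\<close> of its vertices: the number \<open>n\<close> of vertices
  in unary, terminated by a zero bit, followed by the \<open>n \<times> n\<close> adjacency matrix row by row.
  Its length is \<open>n + 1 + n\<^sup>2\<close>.
\<close>

definition encode :: "'a list \<Rightarrow> 'a ugraph \<Rightarrow> bool list" where
  "encode vs G =
     replicate (length vs) True @ [False] @ concat (map (\<lambda>u. map (\<lambda>v. {u, v} \<in> edges G) vs) vs)"

text \<open>
  A problem \<open>L\<close> is in P for the graph class \<open>C\<close> if some deterministic polynomial-time machine
  answers membership in \<open>L\<close> correctly on every encoding of every graph in \<open>C\<close>. On other inputs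
  the machine must still halt in polynomial time, but its answer is irrelevant.
\<close>

definition in_P_for :: "nat ugraph set \<Rightarrow> nat ugraph set \<Rightarrow> bool" where
  "in_P_for C L \<longleftrightarrow>
     (\<exists>M. polytime_tm M \<and>
        (\<forall>G\<in>C. \<forall>vs. distinct vs \<and> set vs = verts G \<longrightarrow>
           (accepts M (encode vs G) \<longleftrightarrow> G \<in> L)))"

end

theory Submission
  imports Defs
begin

text \<open>Adding the nonedge \<open>{u, v}\<close> lowers \<open>alpha\<close> iff every maximum independent set contains both
  \<open>u\<close> and \<open>v\<close>. Hence a graph is \<open>alpha\<close>-unfrozen, and equally \<open>beta\<close>-unfrozen since
  \<open>alpha + beta\<close> is the number of vertices, iff its \<^emph>\<open>core\<close>, the intersection of all maximum
  independent sets, has at most one element.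

  The core of a co-graph is computed by reductions. As long as the remaining induced subgraph has
  an edge, it has adjacent vertices \<open>a\<close>, \<open>b\<close> such that \<open>P = N(a) - N(b)\<close> and \<open>Q = N(b) - N(a)\<close>
  are independent modules (the two sides of a lowest join node of the cotree), say with
  \<open>card P \<le> card Q\<close>. Deleting \<open>P\<close> keeps the core if \<open>card P < card Q\<close>; if the cardinalities
  agree, it only adds \<open>Q\<close> to the core, so the vertices of \<open>Q\<close> lose their mark. Once no edge is
  left, the core consists of the marked survivors.

  To run this on a Turing machine, it is written in a language of bounded loops over Boolean
  arrays and the adjacency matrix, where termination in polynomial time holds by construction.
  That language is compiled to structured tape programs, whose finitely many continuations
  are the states of the machine.\<close>

section \<open>Cores of co-graphs\<close>

text \<open>The reduction is sound for every finite symmetric adjacency relation; co-graphs enter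
  only to guarantee that an edge in any remaining induced subgraph yields a suitable pair
  \<open>a\<close>, \<open>b\<close>. So no cotree is ever built: the condition on \<open>a\<close>,
  \<open>b\<close> compares adjacency rows, which nested loops can check. Nothing is counted on
  tapes either. The cardinalities of \<open>P\<close> and \<open>Q\<close> are compared by matching,
  and the size of the core matters only up to 2, so Boolean arrays suffice and arithmetic is
  avoided. As long as an edge is left, one round over all ordered pairs deletes at least one vertex.
  Hence \<open>n\<close> rounds always suffice, and loops of length \<open>n\<close> are the only
  iteration that the language has to offer.\<close>

definition indep :: "('a \<Rightarrow> 'a \<Rightarrow> bool) \<Rightarrow> 'a set \<Rightarrow> 'a set \<Rightarrow> bool" where
  "indep adj H I \<longleftrightarrow> I \<subseteq> H \<and> (\<forall>x\<in>I. \<forall>y\<in>I. \<not> adj x y)"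

definition max_indep :: "('a \<Rightarrow> 'a \<Rightarrow> bool) \<Rightarrow> 'a set \<Rightarrow> 'a set \<Rightarrow> bool" where
  "max_indep adj H I \<longleftrightarrow> indep adj H I \<and> (\<forall>J. indep adj H J \<longrightarrow> card J \<le> card I)"

definition core :: "('a \<Rightarrow> 'a \<Rightarrow> bool) \<Rightarrow> 'a set \<Rightarrow> 'a set" where
  "core adj H = {x \<in> H. \<forall>I. max_indep adj H I \<longrightarrow> x \<in> I}"

definition private_nbs :: "('a \<Rightarrow> 'a \<Rightarrow> bool) \<Rightarrow> 'a set \<Rightarrow> 'a \<Rightarrow> 'a \<Rightarrow> 'a set" where
  "private_nbs adj H a b = {x \<in> H. adj a x \<and> \<not> adj b x}"

text \<open>If \<open>adj\<close> is symmetric and loopless, \<open>b\<close> lies in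
  \<open>private_nbs adj H a b\<close> and \<open>a\<close> in \<open>private_nbs adj H b a\<close>;
  the two sets are then the classes of vertices with the same neighbourhood in \<open>H\<close> as
  \<open>b\<close> and as \<open>a\<close>. This makes both sets independent and joins them
  completely.\<close>

definition twin_pair :: "('a \<Rightarrow> 'a \<Rightarrow> bool) \<Rightarrow> 'a set \<Rightarrow> 'a \<Rightarrow> 'a \<Rightarrow> bool" where
  "twin_pair adj H a b \<longleftrightarrow> a \<in> H \<and> b \<in> H \<and> adj a b \<and>
     (\<forall>x\<in>private_nbs adj H a b. \<forall>z\<in>H. adj x z = adj b z) \<and>
     (\<forall>x\<in>private_nbs adj H b a. \<forall>z\<in>H. adj x z = adj a z)"

lemma max_indep_exists:
  assumes "finite H"
  obtains I where "max_indep adj H I"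
proof -
  have "finite {I. indep adj H I}"
    by (rule finite_subset[of _ "Pow H"]) (use assms in \<open>auto simp: indep_def\<close>)
  moreover have "indep adj H {}" by (simp add: indep_def)
  ultimately have "Max (card ` {I. indep adj H I}) \<in> card ` {I. indep adj H I}"
    and "\<And>J. indep adj H J \<Longrightarrow> card J \<le> Max (card ` {I. indep adj H I})"
    by (auto intro!: Max_in Max_ge)
  then obtain I where "indep adj H I" "\<And>J. indep adj H J \<Longrightarrow> card J \<le> card I" by auto
  then show ?thesis using that by (auto simp: max_indep_def)
qed

lemma twin_pair_swap: "symp adj \<Longrightarrow> twin_pair adj H a b \<Longrightarrow> twin_pair adj H b a"
  by (auto simp: twin_pair_def dest: sympD)

text \<open>The private neighbourhoods of a twin pair form adjacent modules without inner edges, so an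
  independent set meeting one of them can trade it for the other.\<close>

lemma twin_pair_exchange:
  assumes sym: "symp adj" and tp: "twin_pair adj H a b"
    and I: "indep adj H I" and meet: "I \<inter> private_nbs adj H a b \<noteq> {}"
  shows "indep adj H (I - private_nbs adj H a b \<union> private_nbs adj H b a)"
    and "I \<inter> private_nbs adj H b a = {}"
proof -
  let ?P = "private_nbs adj H a b" and ?Q = "private_nbs adj H b a"
  note * = tp[unfolded twin_pair_def]
  have PP: "adj x z = adj b z" if "x \<in> ?P" "z \<in> H" for x z using * that by blast
  have QQ: "adj x z = adj a z" if "x \<in> ?Q" "z \<in> H" for x z using * that by blast
  have PH: "x \<in> ?P \<longleftrightarrow> x \<in> H \<and> adj a x \<and> \<not> adj b x" for x by (simp add: private_nbs_def)
  have QH: "x \<in> ?Q \<longleftrightarrow> x \<in> H \<and> adj b x \<and> \<not> adj a x" for x by (simp add: private_nbs_def)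
  have IH: "x \<in> I \<Longrightarrow> x \<in> H" and II: "x \<in> I \<Longrightarrow> y \<in> I \<Longrightarrow> \<not> adj x y" for x y
    using I by (auto simp: indep_def)
  obtain p where p: "p \<in> I" "p \<in> ?P" using meet by blast
  show "I \<inter> ?Q = {}" using p PP QH IH II by blast
  \<comment> \<open>A neighbour \<open>z\<close> of \<open>q\<close> is a neighbour of
    \<open>a\<close>, hence of \<open>b\<close> because \<open>z\<close> lies outside
    \<open>P\<close>, hence of every vertex of \<open>P\<close>, in particular of \<open>p\<close>,
    which lies in \<open>I\<close> like \<open>z\<close>.\<close>
  have qz: "\<not> adj q z" if "q \<in> ?Q" "z \<in> I - ?P" for q z
  proof
    assume "adj q z"
    then have "adj b z" using that QQ PH IH by blast
    then have "adj p z" using that p PP IH by blast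
    then show False using that p II by blast
  qed
  have qq: "\<not> adj q q'" if "q \<in> ?Q" "q' \<in> ?Q" for q q' using that QQ QH by blast
  show "indep adj H (I - ?P \<union> ?Q)"
    unfolding indep_def using qz qq II IH QH sympD[OF sym] by blast
qed

lemma indep_finite: "finite H \<Longrightarrow> indep adj H I \<Longrightarrow> finite I"
  by (auto simp: indep_def intro: finite_subset)

text \<open>Only an inequality, because \<open>I\<close> need not contain all of \<open>P\<close>;
  sums avoid truncated subtraction.\<close>

lemma card_exchange:
  assumes "finite I" "finite P" "finite Q" "I \<inter> Q = {}"
  shows "card I + card Q \<le> card (I - P \<union> Q) + card P"
proof -
  have "card (I - P \<union> Q) = card (I - P) + card Q"
    using assms by (intro card_Un_disjoint) auto
  moreover have "card I - card P \<le> card (I - P)" using assms by (simp add: diff_card_le_card_Diff)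
  ultimately show ?thesis by linarith
qed

lemma max_indep_subset:
  assumes "max_indep adj H I" "I \<subseteq> H'" "H' \<subseteq> H"
  shows "max_indep adj H' I"
  using assms unfolding max_indep_def indep_def by (meson order_trans)

lemma max_indep_superset:
  assumes "max_indep adj H I" "I \<subseteq> H'" "H' \<subseteq> H" "max_indep adj H' J"
  shows "max_indep adj H J"
  using assms unfolding max_indep_def indep_def by (meson order_trans)

text \<open>Trading \<open>P\<close> for \<open>Q\<close> enlarges an independent set that meets
  \<open>P\<close> by at least \<open>card Q - card P\<close>. If this is positive, no maximum set
  meets \<open>P\<close>. If it is zero, trades in both directions preserve maximality, so no vertex
  of \<open>P\<close> or \<open>Q\<close> is in all maximum sets, while a trade does not affect the
  other vertices.\<close>

lemma core_delete:
  fixes adj :: "'a \<Rightarrow> 'a \<Rightarrow> bool"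
  assumes fin: "finite H" and sym: "symp adj" and tp: "twin_pair adj H a b"
  defines "P \<equiv> private_nbs adj H a b" and "Q \<equiv> private_nbs adj H b a"
  assumes le: "card P \<le> card Q"
  shows "core adj H = (if card P < card Q then core adj (H - P) else core adj (H - P) - Q)"
proof -
  have PH: "P \<subseteq> H" and QH: "Q \<subseteq> H" and PQ: "P \<inter> Q = {}"
    by (auto simp: P_def Q_def private_nbs_def)
  have finP: "finite P" and finQ: "finite Q" using PH QH fin finite_subset by auto
  have ex: "indep adj H (I - P \<union> Q) \<and> I \<inter> Q = {} \<and> card I + card Q \<le> card (I - P \<union> Q) + card P"
    if "indep adj H I" "I \<inter> P \<noteq> {}" for I
    using twin_pair_exchange[OF sym tp that(1)] that(2) card_exchange[of I P Q]
      indep_finite[OF fin that(1)] finP finQ unfolding P_def Q_def by blast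
  have ex': "indep adj H (I - Q \<union> P) \<and> I \<inter> P = {} \<and> card I + card P \<le> card (I - Q \<union> P) + card Q"
    if "indep adj H I" "I \<inter> Q \<noteq> {}" for I
    using twin_pair_exchange[OF sym twin_pair_swap[OF sym tp] that(1)] that(2) card_exchange[of I Q P]
      indep_finite[OF fin that(1)] finP finQ unfolding P_def Q_def by blast
  have to: "max_indep adj H (I - P \<union> Q)" if "max_indep adj H I" "I \<inter> P \<noteq> {}" for I
    using ex[of I] that le unfolding max_indep_def by (meson add_le_cancel_right add_mono le_trans nat_add_left_cancel_le)
  obtain I0 where I0: "max_indep adj H I0" using max_indep_exists[OF fin] .
  \<comment> \<open>A maximum set avoiding \<open>P\<close> shows that deleting \<open>P\<close>
    does not lower the independence number; this gives \<open>sub\<close>.\<close>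
  obtain I1 where I1: "max_indep adj H I1" "I1 \<inter> P = {}"
  proof (cases "I0 \<inter> P = {}")
    case False
    then show ?thesis using to[OF I0] PQ by (intro that[of "I0 - P \<union> Q"]) auto
  qed (use I0 in auto)
  have I1': "I1 \<subseteq> H - P" using I1 by (auto simp: max_indep_def indep_def)
  have sub: "max_indep adj (H - P) I \<longleftrightarrow> max_indep adj H I \<and> I \<inter> P = {}" for I
  proof
    assume "max_indep adj (H - P) I"
    then show "max_indep adj H I \<and> I \<inter> P = {}"
      using max_indep_superset[OF I1(1) I1', of I] by (auto simp: max_indep_def indep_def)
  next
    assume *: "max_indep adj H I \<and> I \<inter> P = {}"
    then have "I \<subseteq> H - P" by (auto simp: max_indep_def indep_def)
    with * show "max_indep adj (H - P) I" using max_indep_subset[of adj H I "H - P"] by auto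
  qed
  show ?thesis
  proof (cases "card P < card Q")
    case True
    have "I \<inter> P = {}" if "max_indep adj H I" for I
      using ex[of I] that True unfolding max_indep_def by (metis add_le_cancel_right add_less_cancel_left leD le_trans order_less_le_trans)
    then show ?thesis using True sub I1 unfolding core_def by auto
  next
    case False
    with le have eq: "card P = card Q" by simp
    have "x \<in> core adj H \<longleftrightarrow> x \<in> core adj (H - P) - Q" for x
    proof
      assume x: "x \<in> core adj H"
      have "x \<in> I1" using x I1 by (auto simp: core_def)
      have "x \<notin> Q"
      proof
        assume "x \<in> Q"
        then have "I1 \<inter> Q \<noteq> {}" using \<open>x \<in> I1\<close> by blast
        then have "max_indep adj H (I1 - Q \<union> P)" using ex'[of I1] I1 eq unfolding max_indep_def
          by (metis add_le_cancel_right le_trans)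
        then have "x \<in> I1 - Q \<union> P" using x by (auto simp: core_def)
        then show False using \<open>x \<in> Q\<close> PQ by blast
      qed
      then show "x \<in> core adj (H - P) - Q"
        using x sub \<open>x \<in> I1\<close> I1' unfolding core_def by auto
    next
      assume x: "x \<in> core adj (H - P) - Q"
      have "x \<in> I" if "max_indep adj H I" for I
      proof (cases "I \<inter> P = {}")
        case True then show ?thesis using x sub that by (auto simp: core_def)
      next
        case False
        \<comment> \<open>The traded set is maximum in \<open>H - P\<close> and so contains
          \<open>x\<close>; since \<open>x\<close> is not in \<open>Q\<close>, it was already in
          \<open>I\<close>.\<close>
        from to[OF that False] have "max_indep adj (H - P) (I - P \<union> Q)"
          unfolding sub using PQ by blast
        then show ?thesis using x by (auto simp: core_def)
      qed
      then show "x \<in> core adj H" using x by (auto simp: core_def)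
    qed
    then show ?thesis using False by auto
  qed
qed

lemma core_edgeless:
  assumes "finite H" "\<And>x y. x \<in> H \<Longrightarrow> y \<in> H \<Longrightarrow> \<not> adj x y"
  shows "core adj H = H"
proof -
  have "indep adj H H" using assms by (auto simp: indep_def)
  then have "I = H" if "max_indep adj H I" for I
    using that assms(1) unfolding max_indep_def indep_def by (metis card_seteq)
  then show ?thesis by (auto simp: core_def)
qed

section \<open>Twin pairs in induced subgraphs of co-graphs\<close>

abbreviation adjacent :: "'a ugraph \<Rightarrow> 'a \<Rightarrow> 'a \<Rightarrow> bool" where
  "adjacent G u v \<equiv> {u, v} \<in> edges G"

text \<open>A vertex of \<open>H\<close> outside \<open>V\<close> sees all of \<open>V\<close>
  alike, as neighbours or not according to \<open>full\<close>. So it lies in no private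
  neighbourhood and cannot tell two vertices of \<open>V\<close> apart. A union needs
  \<open>full = False\<close>, a join \<open>full = True\<close>.\<close>

lemma twin_pair_outer:
  assumes tp: "twin_pair adj1 (H \<inter> V) a b" and in1: "\<And>x y. x \<in> V \<Longrightarrow> y \<in> V \<Longrightarrow> adj x y = adj1 x y"
    and out: "\<And>x y. x \<in> V \<Longrightarrow> y \<in> H - V \<Longrightarrow> adj x y = full"
  shows "twin_pair adj H a b"
proof -
  have ab: "a \<in> V" "b \<in> V" "a \<in> H" "b \<in> H" "adj1 a b" using tp by (auto simp: twin_pair_def)
  have priv: "private_nbs adj H c d = private_nbs adj1 (H \<inter> V) c d" if "c \<in> V" "d \<in> V" for c d
    using that in1 out unfolding private_nbs_def by blast
  note P = priv[OF ab(1,2)] and Q = priv[OF ab(2,1)]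
  have sub: "private_nbs adj1 (H \<inter> V) c d \<subseteq> V" for c d by (auto simp: private_nbs_def)
  have *: "adj x z = adj c z" if "x \<in> V" "c \<in> V" "z \<in> H" "z \<in> V \<Longrightarrow> adj1 x z = adj1 c z" for x z c
    using that in1 out by (cases "z \<in> V") auto
  show ?thesis unfolding twin_pair_def P Q
    using tp ab in1 sub * unfolding twin_pair_def by (smt (verit, best) IntI subset_iff)
qed

text \<open>The induction ranges over all \<open>H\<close>, since deletions leave arbitrary induced
  subgraphs. An edge inside one part gives a twin pair there, which the other part does not disturb.
  What remains is a join whose parts have no edges inside \<open>H\<close>.\<close>

lemma cograph_twin_pair:
  assumes "cograph G" "H \<subseteq> verts G" "u \<in> H" "v \<in> H" "adjacent G u v"
  shows "\<exists>a b. twin_pair (adjacent G) H a b"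
  using assms
proof (induction arbitrary: H u v rule: cograph.induct)
  case (single v)
  then show ?case by simp
next
  case (union G1 G2)
  have e1: "e \<subseteq> verts G1" if "e \<in> edges G1" for e
    using cograph_simple_graph[OF union(1)] that by (auto simp: simple_graph_def)
  have e2: "e \<subseteq> verts G2" if "e \<in> edges G2" for e
    using cograph_simple_graph[OF union(2)] that by (auto simp: simple_graph_def)
  let ?G = "graph_union G1 G2"
  have adj: "adjacent ?G x y \<longleftrightarrow> adjacent G1 x y \<or> adjacent G2 x y" for x y
    by (auto simp: graph_union_def)
  have H: "H \<subseteq> verts G1 \<union> verts G2" using union.prems(1) by (auto simp: graph_union_def)
  from union.prems(4) adj consider "adjacent G1 u v" | "adjacent G2 u v" by auto
  then show ?case
  proof cases
    case 1
    have "\<exists>a b. twin_pair (adjacent G1) (H \<inter> verts G1) a b"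
      by (rule union.IH(1)[of _ u v]) (use 1 union.prems e1[OF 1] in auto)
    then obtain a b where "twin_pair (adjacent G1) (H \<inter> verts G1) a b" by blast
    then have "twin_pair (adjacent ?G) H a b"
      by (rule twin_pair_outer[where full = False]) (use e1 e2 union.hyps H in \<open>unfold adj, blast+\<close>)
    then show ?thesis by blast
  next
    case 2
    have "\<exists>a b. twin_pair (adjacent G2) (H \<inter> verts G2) a b"
      by (rule union.IH(2)[of _ u v]) (use 2 union.prems e2[OF 2] in auto)
    then obtain a b where "twin_pair (adjacent G2) (H \<inter> verts G2) a b" by blast
    then have "twin_pair (adjacent ?G) H a b"
      by (rule twin_pair_outer[where full = False]) (use e1 e2 union.hyps H in \<open>unfold adj, blast+\<close>)
    then show ?thesis by blast
  qed
next
  case (join G1 G2)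
  have e1: "e \<subseteq> verts G1" if "e \<in> edges G1" for e
    using cograph_simple_graph[OF join(1)] that by (auto simp: simple_graph_def)
  have e2: "e \<subseteq> verts G2" if "e \<in> edges G2" for e
    using cograph_simple_graph[OF join(2)] that by (auto simp: simple_graph_def)
  let ?G = "graph_join G1 G2"
  have adj: "adjacent ?G x y \<longleftrightarrow> adjacent G1 x y \<or> adjacent G2 x y \<or>
      x \<in> verts G1 \<and> y \<in> verts G2 \<or> x \<in> verts G2 \<and> y \<in> verts G1" for x y
    by (auto simp: graph_join_def doubleton_eq_iff)
  have H: "H \<subseteq> verts G1 \<union> verts G2" using join.prems(1) by (auto simp: graph_join_def)
  consider (1) x y where "x \<in> H" "y \<in> H" "adjacent G1 x y" | (2) x y where "x \<in> H" "y \<in> H" "adjacent G2 x y"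
    | (3) "\<And>x y. x \<in> H \<Longrightarrow> y \<in> H \<Longrightarrow> \<not> adjacent G1 x y \<and> \<not> adjacent G2 x y" by blast
  then show ?case
  proof cases
    case 1
    have "\<exists>a b. twin_pair (adjacent G1) (H \<inter> verts G1) a b"
      by (rule join.IH(1)[of _ x y]) (use 1 e1[OF 1(3)] in auto)
    then obtain a b where "twin_pair (adjacent G1) (H \<inter> verts G1) a b" by blast
    then have "twin_pair (adjacent ?G) H a b"
      by (rule twin_pair_outer[where full = True]) (use e1 e2 join.hyps H in \<open>unfold adj, blast+\<close>)
    then show ?thesis by blast
  next
    case 2
    have "\<exists>a b. twin_pair (adjacent G2) (H \<inter> verts G2) a b"
      by (rule join.IH(2)[of _ x y]) (use 2 e2[OF 2(3)] in auto)
    then obtain a b where "twin_pair (adjacent G2) (H \<inter> verts G2) a b" by blast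
    then have "twin_pair (adjacent ?G) H a b"
      by (rule twin_pair_outer[where full = True]) (use e1 e2 join.hyps H in \<open>unfold adj, blast+\<close>)
    then show ?thesis by blast
  next
    case 3
    \<comment> \<open>Here \<open>H\<close> induces a complete bipartite graph, and the private
      neighbourhoods of \<open>u\<close> and \<open>v\<close> are its two sides.\<close>
    have adj': "adjacent ?G x y \<longleftrightarrow> x \<in> verts G1 \<and> y \<in> verts G2 \<or> x \<in> verts G2 \<and> y \<in> verts G1"
      if "x \<in> H" "y \<in> H" for x y using adj 3 that by blast
    have "twin_pair (adjacent ?G) H u v"
      unfolding twin_pair_def private_nbs_def using adj' join.prems join.hyps H
      by (smt (verit, best) Un_iff disjoint_iff mem_Collect_eq subset_iff)
    then show ?thesis by blast
  qed
qed

section \<open>Independence number, vertex cover number and the core\<close>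

lemma simple_graph_adjacent: "simple_graph G \<Longrightarrow> symp (adjacent G) \<and> irreflp (adjacent G)"
  by (fastforce simp: simple_graph_def symp_def irreflp_def insert_commute)

text \<open>Edges have two distinct ends, so admitting \<open>x = y\<close> in \<open>indep\<close>
  excludes nothing more.\<close>

lemma indep_adjacent:
  assumes "simple_graph G"
  shows "indep (adjacent G) (verts G) S \<longleftrightarrow> independent_set G S"
proof -
  have "(\<exists>e\<in>edges G. e \<subseteq> S) \<longleftrightarrow> (\<exists>x\<in>S. \<exists>y\<in>S. {x, y} \<in> edges G)"
    using assms unfolding simple_graph_def by (metis card_2_iff empty_subsetI insert_subset)
  then show ?thesis unfolding indep_def independent_set_def by blast
qed

lemma alpha_eq_card:
  assumes "simple_graph G" "max_indep (adjacent G) (verts G) I"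
  shows "alpha G = card I"
  unfolding alpha_def
proof (rule Max_eqI)
  have "{S. independent_set G S} \<subseteq> Pow (verts G)" by (auto simp: independent_set_def)
  then show "finite (card ` {S. independent_set G S})"
    using assms(1) finite_subset[of _ "Pow (verts G)"] by (simp add: simple_graph_def)
qed (use assms indep_adjacent[OF assms(1)] in \<open>auto simp: max_indep_def\<close>)

text \<open>Gallai's identity: the complements of vertex covers are the independent sets.\<close>

lemma beta_eq:
  assumes "simple_graph G"
  shows "beta G = card (verts G) - alpha G"
proof -
  have fin: "finite (verts G)" using assms by (simp add: simple_graph_def)
  obtain I where I: "max_indep (adjacent G) (verts G) I" using max_indep_exists[OF fin] .
  have IV: "I \<subseteq> verts G" using I by (auto simp: max_indep_def indep_def)
  have cov: "vertex_cover G C \<longleftrightarrow> C \<subseteq> verts G \<and> independent_set G (verts G - C)" for C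
  proof -
    have "e \<inter> C \<noteq> {} \<longleftrightarrow> \<not> e \<subseteq> verts G - C" if "e \<in> edges G" for e
      using assms that by (auto simp: simple_graph_def)
    then show ?thesis by (auto simp: vertex_cover_def independent_set_def)
  qed
  have "beta G = card (verts G) - card I"
    unfolding beta_def
  proof (rule Min_eqI)
    have "{C. vertex_cover G C} \<subseteq> Pow (verts G)" by (auto simp: vertex_cover_def)
    then show "finite (card ` {C. vertex_cover G C})"
      using fin finite_subset[of _ "Pow (verts G)"] by simp
    have "vertex_cover G (verts G - I)"
      unfolding cov using I IV indep_adjacent[OF assms] by (auto simp: max_indep_def double_diff)
    moreover have "card (verts G - I) = card (verts G) - card I"
      using IV fin by (simp add: card_Diff_subset finite_subset)
    ultimately show "card (verts G) - card I \<in> card ` {C. vertex_cover G C}" by (metis imageI mem_Collect_eq)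
    fix y assume "y \<in> card ` {C. vertex_cover G C}"
    then obtain C where C: "C \<subseteq> verts G" "independent_set G (verts G - C)" "y = card C" by (auto simp: cov)
    then have "card (verts G - C) \<le> card I" using I indep_adjacent[OF assms] by (auto simp: max_indep_def)
    then show "card (verts G) - card I \<le> y"
      using C fin by (simp add: card_Diff_subset finite_subset)
  qed
  then show ?thesis using alpha_eq_card[OF assms I] by simp
qed

lemma simple_add_edge:
  assumes "simple_graph G" "e \<in> nonedges G"
  shows "simple_graph (add_edge G e)"
  using assms by (auto simp: simple_graph_def nonedges_def add_edge_def)

text \<open>Keeps the truncated subtraction in \<open>beta_eq\<close> faithful, so that equal values
  of \<open>beta\<close> force equal values of \<open>alpha\<close>.\<close>

lemma alpha_le: "simple_graph G \<Longrightarrow> alpha G \<le> card (verts G)"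
proof -
  assume G: "simple_graph G"
  then have fin: "finite (verts G)" by (simp add: simple_graph_def)
  obtain I where I: "max_indep (adjacent G) (verts G) I" using max_indep_exists[OF fin] .
  then have "I \<subseteq> verts G" by (auto simp: max_indep_def indep_def)
  then show ?thesis using alpha_eq_card[OF G I] card_mono[OF fin] by simp
qed

lemma unfrozen_beta_alpha:
  assumes "simple_graph G"
  shows "unfrozen beta G \<longleftrightarrow> unfrozen alpha G"
proof -
  have "beta (add_edge G e) = beta G \<longleftrightarrow> alpha (add_edge G e) = alpha G" if "e \<in> nonedges G" for e
    using beta_eq[OF assms] beta_eq[OF simple_add_edge[OF assms that]]
      alpha_le[OF assms] alpha_le[OF simple_add_edge[OF assms that]]
    by (auto simp: add_edge_def)
  then show ?thesis by (simp add: unfrozen_def)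
qed

lemma unfrozen_alpha_core:
  assumes G: "simple_graph G"
  shows "unfrozen alpha G \<longleftrightarrow> card (core (adjacent G) (verts G)) \<le> 1"
proof -
  let ?c = "core (adjacent G) (verts G)"
  have fin: "finite (verts G)" using G by (simp add: simple_graph_def)
  then have fc: "finite ?c" by (simp add: core_def)
  obtain I where I: "max_indep (adjacent G) (verts G) I" using max_indep_exists[OF fin] .
  have frozen: "alpha (add_edge G {u, v}) \<noteq> alpha G \<longleftrightarrow> u \<in> ?c \<and> v \<in> ?c"
    if uv: "u \<in> verts G" "v \<in> verts G" "u \<noteq> v" "{u, v} \<notin> edges G" for u v
  proof -
    let ?G = "add_edge G {u, v}"
    have ne: "{u, v} \<in> nonedges G" using uv by (auto simp: nonedges_def)
    note G' = simple_add_edge[OF G ne]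
    have ind: "indep (adjacent ?G) (verts ?G) S \<longleftrightarrow>
        indep (adjacent G) (verts G) S \<and> \<not> (u \<in> S \<and> v \<in> S)" for S
      unfolding indep_adjacent[OF G] indep_adjacent[OF G'] by (auto simp: independent_set_def add_edge_def)
    obtain J where J: "max_indep (adjacent ?G) (verts ?G) J"
      using max_indep_exists G' simple_graph_def by metis
    have a: "alpha G = card I" "alpha ?G = card J"
      using alpha_eq_card[OF G I] alpha_eq_card[OF G' J] by auto
    have "card J = card I \<longleftrightarrow> (\<exists>I. max_indep (adjacent G) (verts G) I \<and> \<not> (u \<in> I \<and> v \<in> I))"
    proof
      assume "card J = card I"
      then have "max_indep (adjacent G) (verts G) J" using I J ind by (simp add: max_indep_def)
      then show "\<exists>I. max_indep (adjacent G) (verts G) I \<and> \<not> (u \<in> I \<and> v \<in> I)"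
        using J ind unfolding max_indep_def by blast
    next
      assume "\<exists>I. max_indep (adjacent G) (verts G) I \<and> \<not> (u \<in> I \<and> v \<in> I)"
      then obtain I' where I': "max_indep (adjacent G) (verts G) I'" "\<not> (u \<in> I' \<and> v \<in> I')" by blast
      then have "max_indep (adjacent ?G) (verts ?G) I'" using ind unfolding max_indep_def by blast
      then have "card J \<le> card I'" "card I' \<le> card J" "card I' \<le> card I" "card I \<le> card I'"
        using I I' J unfolding max_indep_def by blast+
      then show "card J = card I" by simp
    qed
    then show ?thesis using uv a by (auto simp: core_def)
  qed
  \<comment> \<open>Two core vertices lie in a common maximum independent set, so distinct ones form
    a nonedge and \<open>frozen\<close> applies to them.\<close>
  have noadj: "{u, v} \<notin> edges G" if "u \<in> ?c" "v \<in> ?c" for u v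
    using that I by (auto simp: core_def max_indep_def indep_def)
  have "unfrozen alpha G \<longleftrightarrow> (\<forall>u\<in>?c. \<forall>v\<in>?c. u = v)"
  proof
    assume u: "unfrozen alpha G"
    show "\<forall>u\<in>?c. \<forall>v\<in>?c. u = v"
    proof (intro ballI, rule ccontr)
      fix u v assume *: "u \<in> ?c" "v \<in> ?c" "u \<noteq> v"
      then have "u \<in> verts G" "v \<in> verts G" by (auto simp: core_def)
      with frozen[OF this *(3) noadj[OF *(1,2)]] * noadj[OF *(1,2)] u show False
        unfolding unfrozen_def nonedges_def by blast
    qed
  next
    assume "\<forall>u\<in>?c. \<forall>v\<in>?c. u = v"
    then show "unfrozen alpha G" using frozen unfolding unfrozen_def nonedges_def by blast
  qed
  also have "\<dots> \<longleftrightarrow> card ?c \<le> 1"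
    using fc by (auto simp: card_le_Suc0_iff_eq)
  finally show ?thesis .
qed

section \<open>Transport of cores and twin pairs from vertices to their positions in an
  enumeration\<close>

lemma indep_image:
  assumes "inj_on f H"
  shows "indep adj (f ` H) J \<longleftrightarrow> (\<exists>I. J = f ` I \<and> indep (\<lambda>x y. adj (f x) (f y)) H I)"
  unfolding indep_def by (auto simp: subset_image_iff)

lemma core_image:
  assumes inj: "inj_on f H"
  shows "core adj (f ` H) = f ` core (\<lambda>x y. adj (f x) (f y)) H"
proof -
  let ?adj = "\<lambda>x y. adj (f x) (f y)"
  have c: "card (f ` I) = card I" if "indep ?adj H I" for I
    using that inj by (auto simp: indep_def intro: card_image inj_on_subset)
  have m: "max_indep adj (f ` H) J \<longleftrightarrow> (\<exists>I. J = f ` I \<and> max_indep ?adj H I)" for J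
  proof -
    have "(\<forall>J'. indep adj (f ` H) J' \<longrightarrow> card J' \<le> k) \<longleftrightarrow> (\<forall>I. indep ?adj H I \<longrightarrow> card I \<le> k)" for k
      unfolding indep_image[OF inj] using c by auto
    then show ?thesis unfolding max_indep_def indep_image[OF inj] using c by auto
  qed
  have f: "f x \<in> f ` I \<longleftrightarrow> x \<in> I" if "x \<in> H" "max_indep ?adj H I" for x I
    by (rule inj_on_image_mem_iff[OF inj that(1)]) (use that(2) in \<open>simp add: max_indep_def indep_def\<close>)
  have 1: "y \<in> core adj (f ` H) \<longleftrightarrow> y \<in> f ` H \<and> (\<forall>I. max_indep ?adj H I \<longrightarrow> y \<in> f ` I)" for y
    by (auto simp: core_def m)
  have 2: "f x \<in> f ` core ?adj H \<longleftrightarrow> x \<in> core ?adj H" if "x \<in> H" for x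
    by (rule inj_on_image_mem_iff[OF inj that]) (auto simp: core_def)
  have eq: "f x \<in> core adj (f ` H) \<longleftrightarrow> f x \<in> f ` core ?adj H" if "x \<in> H" for x
    unfolding 1 2[OF that] using f[OF that] that by (auto simp: core_def)
  have sub: "core adj (f ` H) \<subseteq> f ` H" "f ` core ?adj H \<subseteq> f ` H" by (auto simp: core_def)
  show ?thesis
  proof (rule set_eqI)
    fix y
    show "y \<in> core adj (f ` H) \<longleftrightarrow> y \<in> f ` core ?adj H"
    proof (cases "y \<in> f ` H")
      case True
      then show ?thesis using eq by auto
    next
      case False
      then show ?thesis using sub by (meson subsetD)
    qed
  qed
qed

lemma private_nbs_image:
  "private_nbs adj (f ` H) (f a) (f b) = f ` private_nbs (\<lambda>x y. adj (f x) (f y)) H a b"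
  by (auto simp: private_nbs_def)

lemma twin_pair_image:
  "twin_pair adj (f ` H) (f a) (f b) \<Longrightarrow> a \<in> H \<Longrightarrow> b \<in> H \<Longrightarrow> twin_pair (\<lambda>x y. adj (f x) (f y)) H a b"
  unfolding twin_pair_def private_nbs_image ball_simps(9) by (elim conjE, intro conjI)

section \<open>Structured tape programs\<close>

text \<open>A list of commands is a continuation: the commands still to be executed. \<open>While i S c\<close>
  repeats \<open>c\<close> until tape \<open>i\<close> reads a symbol in \<open>S\<close>. The empty list accepts, \<open>[Rej]\<close> rejects.\<close>

datatype com =
    Wr nat nat
  | Mv nat dir
  | Cond nat nat "com list" "com list"
  | While nat "nat set" "com list"
  | Rej

fun cell :: "com \<Rightarrow> nat" where
  "cell (Wr i s) = i"
| "cell (Mv i d) = i"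
| "cell (Cond i s a b) = i"
| "cell (While i S c) = i"
| "cell Rej = 0"

text \<open>A step splits into the next continuation (\<open>ctrl\<close>) and the action on one
  tape (\<open>act\<close>). Both depend only on the continuation and the symbol under one head,
  which a transition function can see. Finished programs formally look at tape 0, but write back
  what they read.\<close>

fun ctrl :: "nat \<Rightarrow> com list \<Rightarrow> com list" where
  "ctrl r (Wr i s # k) = k"
| "ctrl r (Mv i d # k) = k"
| "ctrl r (Cond i s a b # k) = (if r = s then a else b) @ k"
| "ctrl r (While i S c # k) = (if r \<in> S then k else c @ While i S c # k)"
| "ctrl r (Rej # k) = Rej # k"
| "ctrl r [] = []"

text \<open>Clipping at 2 keeps every command within the three-symbol alphabet.\<close>

fun act :: "nat \<Rightarrow> com list \<Rightarrow> nat \<times> dir" where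
  "act r (Wr i s # k) = (min s 2, Stay)"
| "act r (Mv i d # k) = (r, d)"
| "act r _ = (r, Stay)"

fun cell_of :: "com list \<Rightarrow> nat" where
  "cell_of [] = 0"
| "cell_of (c # k) = cell c"

type_synonym tapes = "nat \<Rightarrow> tape"

definition cstep :: "com list \<times> tapes \<Rightarrow> com list \<times> tapes" where
  "cstep c = (case c of (cs, T) \<Rightarrow>
     let i = cell_of cs; r = tape_read (T i) in (ctrl r cs, T(i := tape_act (act r cs) (T i))))"

definition inp :: "bool list \<Rightarrow> tapes" where
  "inp x = (\<lambda>i. if i = 0 then input_tape x else blank_tape)"

section \<open>Finiteness of the set of reachable continuations\<close>

definition step_closed :: "com list set \<Rightarrow> bool" where
  "step_closed R \<longleftrightarrow> (\<forall>cs\<in>R. \<forall>r. ctrl r cs \<in> R)"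

lemma ctrl_append: "x \<noteq> [] \<Longrightarrow> ctrl r (x @ k) = ctrl r x @ k"
  by (cases "(r, x)" rule: ctrl.cases) auto

lemma step_closed_append:
  assumes "step_closed R" "step_closed S" "k \<in> S"
  shows "step_closed ((\<lambda>x. x @ k) ` R \<union> S)"
  unfolding step_closed_def
proof (intro ballI allI)
  fix y r assume y: "y \<in> (\<lambda>x. x @ k) ` R \<union> S"
  show "ctrl r y \<in> (\<lambda>x. x @ k) ` R \<union> S"
  proof (cases "y \<in> S")
    case True then show ?thesis using assms by (auto simp: step_closed_def)
  next
    case False
    then obtain x where x: "x \<in> R" "y = x @ k" using y by blast
    then have "x \<noteq> []" using False assms by auto
    then show ?thesis using x assms ctrl_append[of x r k] by (auto simp: step_closed_def)
  qed
qed

definition fincl :: "com list \<Rightarrow> bool" where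
  "fincl cs \<longleftrightarrow> (\<exists>R. finite R \<and> step_closed R \<and> cs \<in> R)"

lemma fincl_append:
  assumes "fincl a" "fincl b" shows "fincl (a @ b)"
proof -
  obtain R S where "finite R" "step_closed R" "a \<in> R" "finite S" "step_closed S" "b \<in> S"
    using assms by (auto simp: fincl_def)
  then show ?thesis unfolding fincl_def
    by (intro exI[of _ "(\<lambda>x. x @ b) ` R \<union> S"]) (auto intro: step_closed_append)
qed

lemma fincl_step:
  assumes "finite (range (\<lambda>r. ctrl r cs))" "\<And>r. fincl (ctrl r cs)"
  shows "fincl cs"
proof -
  obtain f where f: "\<And>r. finite (f r) \<and> step_closed (f r) \<and> ctrl r cs \<in> f r"
    using assms(2) unfolding fincl_def by metis
  \<comment> \<open>Infinitely many symbols \<open>r\<close> lead to finitely many successors; one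
    representative symbol per successor keeps the union finite.\<close>
  define pick where "pick y = (SOME r. ctrl r cs = y)" for y
  have pick: "ctrl (pick (ctrl r cs)) cs = ctrl r cs" for r unfolding pick_def by (rule someI) simp
  let ?R = "insert cs (\<Union>y\<in>range (\<lambda>r. ctrl r cs). f (pick y))"
  have "finite ?R" using f by (intro finite.insertI finite_UN_I assms(1)) auto
  moreover have "step_closed ?R" unfolding step_closed_def
  proof (intro ballI allI)
    fix y r assume "y \<in> ?R"
    then consider "y = cs" | s where "y \<in> f (pick (ctrl s cs))" by auto
    then show "ctrl r y \<in> ?R"
    proof cases
      case 1
      have "ctrl r cs \<in> f (pick (ctrl r cs))" using f pick by metis
      then show ?thesis using 1 by auto
    next
      case 2
      then have "ctrl r y \<in> f (pick (ctrl s cs))" using f by (auto simp: step_closed_def)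
      then show ?thesis by auto
    qed
  qed
  ultimately show ?thesis unfolding fincl_def by blast
qed

lemma fincl_Nil: "fincl []"
  unfolding fincl_def step_closed_def by (intro exI[of _ "{[]}"]) auto

text \<open>Unfolding the loop does not pile up copies: inside it, the continuation is always some
  \<open>x\<close> reachable from the body, followed by the loop itself.\<close>

lemma fincl_While:
  assumes "fincl c" shows "fincl [While i S c]"
proof -
  let ?W = "[While i S c]"
  obtain R where R: "finite R" "step_closed R" "c \<in> R" using assms by (auto simp: fincl_def)
  let ?S = "insert [] ((\<lambda>x. x @ ?W) ` R \<union> {?W})"
  have "step_closed ?S" unfolding step_closed_def
  proof (intro ballI allI)
    fix y r assume "y \<in> ?S"
    then consider "y = []" | "y = ?W" | x where "x \<in> R" "x \<noteq> []" "y = x @ ?W" by blast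
    then show "ctrl r y \<in> ?S"
    proof cases
      case 3
      then have "ctrl r y = ctrl r x @ ?W" "ctrl r x \<in> R" using ctrl_append R by (auto simp: step_closed_def)
      then show ?thesis by blast
    qed (use R in auto)
  qed
  then show ?thesis using R unfolding fincl_def by (intro exI[of _ ?S]) auto
qed

lemma fincl_single: "(\<forall>x\<in>set cs. fincl [x]) \<Longrightarrow> fincl cs"
proof (induction cs)
  case (Cons a cs) then show ?case using fincl_append[of "[a]" cs] by simp
qed (rule fincl_Nil)

lemma fincl_com: "fincl [c]"
proof (induction c)
  case (Cond i s a b)
  have "fincl a" by (rule fincl_single) (use Cond in simp)
  moreover have "fincl b" by (rule fincl_single) (use Cond in simp)
  moreover have "finite (range (\<lambda>r. ctrl r [Cond i s a b]))"
    by (rule finite_subset[of _ "{a, b}"]) auto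
  ultimately show ?case by - (rule fincl_step, simp_all)
next
  case (While i S c)
  then have "fincl c" by (intro fincl_single) simp
  then show ?case by (rule fincl_While)
next
  case Rej
  show ?case unfolding fincl_def step_closed_def by (intro exI[of _ "{[Rej]}"]) auto
next
  case (Wr i s)
  show ?case by (rule fincl_step) (simp_all add: fincl_Nil)
next
  case (Mv i d)
  show ?case by (rule fincl_step) (simp_all add: fincl_Nil)
qed

lemma fincl: "fincl cs" using fincl_single fincl_com by blast

section \<open>From tape programs to Turing machines\<close>

lemma finite_enumeration_from:
  assumes "finite S" "a \<in> S"
  obtains dec and N :: nat where "bij_betw dec {..<N} S" "dec 0 = a" "0 < N"
proof -
  obtain xs where xs: "distinct xs" "set xs = S - {a}"
    using finite_distinct_list[of "S - {a}"] assms(1) by auto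
  have "bij_betw (\<lambda>i. (a # xs) ! i) {..<length (a # xs)} (set (a # xs))"
    by (rule bij_betw_nth) (use xs in auto)
  moreover have "set (a # xs) = S" using xs assms(2) by auto
  ultimately show ?thesis using that[of "\<lambda>i. (a # xs) ! i" "length (a # xs)"] by simp
qed

definition final :: "com list \<Rightarrow> bool" where
  "final cs \<longleftrightarrow> cs = [] \<or> cs = [Rej]"

lemma tape_act_read: "tape_act (tape_read t, Stay) t = t"
  by (cases t) auto

lemma cstep_final: "final cs \<Longrightarrow> cstep (cs, T) = (cs, T)"
  by (auto simp: final_def cstep_def Let_def tape_act_read)

text \<open>States are numbers of continuations. The numbering \<open>enc\<close> is known to be
  injective only on the closed set \<open>R\<close>, so its faithfulness is stated along
  runs.\<close>

theorem tm_of_com: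
  fixes cs :: "com list"
  obtains M enc where "wf_tm M"
    "\<And>x t k. final k \<Longrightarrow> enc (fst ((cstep ^^ t) (cs, inp x))) = enc k \<longleftrightarrow> fst ((cstep ^^ t) (cs, inp x)) = k"
    "acc_state M = enc []" "rej_state M = enc [Rej]"
    "\<And>x t. fst (tm_run M x t) = enc (fst ((cstep ^^ t) (cs, inp x)))"
proof -
  obtain R0 where R0: "finite R0" "step_closed R0" "cs \<in> R0" using fincl[of cs] by (auto simp: fincl_def)
  \<comment> \<open>Both final continuations are included even if unreachable, since the machine
    needs two distinct halting states.\<close>
  define R where "R = R0 \<union> {[], [Rej]}"
  have R: "finite R" "step_closed R" "cs \<in> R" "[] \<in> R" "[Rej] \<in> R"
    using R0 by (auto simp: R_def step_closed_def)
  obtain N where N: "\<And>k. k \<in> R \<Longrightarrow> cell_of k < N" "1 \<le> N"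
  proof -
    have "finite (cell_of ` R)" using R by simp
    then have "\<forall>i\<in>cell_of ` R. i < Suc (Max (cell_of ` R))" by (simp add: less_Suc_eq_le)
    then show ?thesis using that[of "Suc (Max (cell_of ` R))"] by auto
  qed
  \<comment> \<open>State 0 is the start state, so the numbering has to begin with
    \<open>cs\<close>.\<close>
  obtain dec S where dec: "bij_betw dec {..<S::nat} R" "dec 0 = cs" "0 < S"
    using finite_enumeration_from[OF R(1,3)] .
  define enc where "enc = inv_into {..<S} dec"
  have enc: "bij_betw enc R {..<S}" unfolding enc_def by (rule bij_betw_inv_into[OF dec(1)])
  have dec_enc: "dec (enc k) = k" if "k \<in> R" for k
    unfolding enc_def using that dec(1) by (metis bij_betw_inv_into_right)
  have enc_lt: "enc k < S" if "k \<in> R" for k using enc that bij_betwE by fastforce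
  have enc0: "enc cs = 0" unfolding enc_def using dec by (metis bij_betw_inv_into_left lessThan_iff)
  define M where "M = \<lparr>num_tapes = N, num_states = S, num_symbols = 3, acc_state = enc [], rej_state = enc [Rej],
     delta = (\<lambda>q ss. let k = dec q; i = cell_of k; r = ss ! i in
        (enc (ctrl r k), map (\<lambda>j. if j = i then act r k else (ss ! j, Stay)) [0..<N]))\<rparr>"
  have inj: "enc k = enc k' \<longleftrightarrow> k = k'" if "k \<in> R" "k' \<in> R" for k k'
    using that dec_enc by metis
  have act3: "fst (act r k) < 3" if "r < 3" for r k
    using that by (cases "(r, k)" rule: act.cases) auto
  have wf: "wf_tm M"
    unfolding wf_tm_def
  proof (intro conjI allI impI)
    show "1 \<le> num_tapes M" "3 \<le> num_symbols M" "0 < num_states M" using N dec by (auto simp: M_def)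
    show "acc_state M < num_states M" "rej_state M < num_states M" "acc_state M \<noteq> rej_state M"
      using enc_lt R inj by (auto simp: M_def)
    fix q ss assume a: "q < num_states M \<and> length ss = num_tapes M \<and> (\<forall>s\<in>set ss. s < num_symbols M)"
    then have k: "dec q \<in> R" using dec(1) bij_betwE by (fastforce simp: M_def)
    have ss: "ss ! j < 3" if "j < N" for j using a that by (auto simp: M_def)
    have "enc (ctrl r (dec q)) < S" for r using k R(2) enc_lt by (simp add: step_closed_def)
    moreover have "fst (act (ss ! cell_of (dec q)) (dec q)) < 3" using ss N(1)[OF k] act3 by simp
    ultimately show "case delta M q ss of (q', acts) \<Rightarrow>
           q' < num_states M \<and> length acts = num_tapes M \<and> (\<forall>(s, d)\<in>set acts. s < num_symbols M)"
      using ss by (auto simp: M_def Let_def split_beta)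
  qed
  have sim: "tm_step M (enc k, map T [0..<N]) = (enc (fst (cstep (k, T))), map (snd (cstep (k, T))) [0..<N])"
    if k: "k \<in> R" for k T
  proof (cases "final k")
    case True
    then have "halted M (enc k, map T [0..<N])" by (auto simp: halted_def M_def final_def)
    then show ?thesis using cstep_final[OF True] by (simp add: tm_step_def)
  next
    case False
    then have "\<not> halted M (enc k, map T [0..<N])" using k R inj by (auto simp: halted_def M_def final_def)
    then show ?thesis
      using N(1)[OF k] by (auto simp: tm_step_def M_def Let_def cstep_def dec_enc[OF k] tape_act_read
          map2_map_map intro!: nth_equalityI)
  qed
  have run: "fst ((cstep ^^ t) (cs, inp x)) \<in> R \<and>
     tm_run M x t = (enc (fst ((cstep ^^ t) (cs, inp x))), map (snd ((cstep ^^ t) (cs, inp x))) [0..<N])" for x t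
  proof (induction t)
    case 0
    have "[0..<N] = 0 # [1..<N]" using N(2) by (simp add: upt_conv_Cons)
    moreover have "map (inp x) [1..<N] = replicate (N - 1) blank_tape"
      by (auto simp: inp_def intro!: nth_equalityI)
    ultimately show ?case using R enc0 by (simp add: tm_run_def tm_init_def M_def inp_def)
  next
    case (Suc t)
    obtain k T where kT: "(cstep ^^ t) (cs, inp x) = (k, T)" by fastforce
    have "k \<in> R" using Suc kT by simp
    moreover have "fst (cstep (k, T)) \<in> R" using \<open>k \<in> R\<close> R(2) by (auto simp: cstep_def Let_def step_closed_def)
    ultimately show ?case using Suc sim[of k T] by (simp add: kT tm_run_def)
  qed
  have "enc (fst ((cstep ^^ t) (cs, inp x))) = enc k \<longleftrightarrow> fst ((cstep ^^ t) (cs, inp x)) = k"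
    if "final k" for x t k
    by (rule inj) (use that run R in \<open>auto simp: final_def\<close>)
  then show ?thesis using that[of M enc] wf run by (simp add: M_def)
qed

text \<open>Final continuations are fixed points of \<open>cstep\<close>, so an outcome reached
  within the bound is still there at time \<open>poly p (length x)\<close>, where
  \<open>polytime_tm\<close> looks for it.\<close>

corollary decide_by_com:
  assumes halt: "\<And>x. \<exists>t \<le> poly p (length x). fst ((cstep ^^ t) (cs, inp x)) = (if A x then [] else [Rej])"
  shows "\<exists>M. polytime_tm M \<and> (\<forall>x. accepts M x \<longleftrightarrow> A x)"
proof -
  obtain M enc where M: "wf_tm M"
    "\<And>x t k. final k \<Longrightarrow> enc (fst ((cstep ^^ t) (cs, inp x))) = enc k \<longleftrightarrow> fst ((cstep ^^ t) (cs, inp x)) = k"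
    "acc_state M = enc []" "rej_state M = enc [Rej]"
    "\<And>x t. fst (tm_run M x t) = enc (fst ((cstep ^^ t) (cs, inp x)))" by (rule tm_of_com[of cs]) blast
  have later: "(cstep ^^ s) (cs, inp x) = (cstep ^^ t) (cs, inp x)"
    if "final (fst ((cstep ^^ t) (cs, inp x)))" "t \<le> s" for t s x
    using that(2)
  proof (induction s rule: dec_induct)
    case (step s) then show ?case using that(1) cstep_final by (metis comp_apply funpow.simps(2) prod.collapse)
  qed simp
  have fin: "final (if b then [] else [Rej])" for b by (simp add: final_def)
  have out: "fst ((cstep ^^ s) (cs, inp x)) = (if A x then [] else [Rej])"
    if "poly p (length x) \<le> s" for s x
  proof -
    obtain t where t: "t \<le> poly p (length x)" "fst ((cstep ^^ t) (cs, inp x)) = (if A x then [] else [Rej])"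
      using halt by blast
    have "(cstep ^^ s) (cs, inp x) = (cstep ^^ t) (cs, inp x)"
    proof (rule later)
      show "final (fst ((cstep ^^ t) (cs, inp x)))" unfolding t(2) by (rule fin)
      show "t \<le> s" using t(1) that by simp
    qed
    then show ?thesis using t by simp
  qed
  have "halted M (tm_run M x (poly p (length x)))" for x
    unfolding halted_def M(3-5) out[OF order_refl] by simp
  then have "polytime_tm M" unfolding polytime_tm_def using M(1) by blast
  moreover have "accepts M x \<longleftrightarrow> A x" for x
  proof
    assume "accepts M x"
    then obtain t where "enc (fst ((cstep ^^ t) (cs, inp x))) = enc []"
      unfolding accepts_def M(3,5) by blast
    then have t: "fst ((cstep ^^ t) (cs, inp x)) = []"
      using M(2)[of "[]"] by (simp add: final_def)
    let ?s = "max t (poly p (length x))"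
    have "(cstep ^^ ?s) (cs, inp x) = (cstep ^^ t) (cs, inp x)" by (rule later) (auto simp: t final_def)
    then show "A x" using out[of x ?s] t by (auto split: if_splits)
  next
    assume "A x"
    then show "accepts M x" unfolding accepts_def M(3,5)
      using out[of x "poly p (length x)"] by (intro exI[of _ "poly p (length x)"]) simp
  qed
  ultimately show ?thesis by blast
qed

text \<open>One time \<open>t\<close> serves all continuations \<open>k\<close>, which makes runs
  composable; \<open>b\<close> only bounds \<open>t\<close>, so different branches can share a
  bound.\<close>

definition exec :: "com list \<Rightarrow> tapes \<Rightarrow> nat \<Rightarrow> tapes \<Rightarrow> bool" where
  "exec cs T b T' \<longleftrightarrow> (\<exists>t\<le>b. \<forall>k. (cstep ^^ t) (cs @ k, T) = (k, T'))"

lemma exec_Nil: "exec [] T b T"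
  unfolding exec_def by (intro exI[of _ 0]) auto

lemma exec_mono: "exec cs T b T' \<Longrightarrow> b \<le> b' \<Longrightarrow> exec cs T b' T'"
  unfolding exec_def using le_trans by blast

lemma exec_append:
  assumes "exec a T b T1" "exec c T1 b' T2"
  shows "exec (a @ c) T (b + b') T2"
proof -
  obtain t t' where t: "t \<le> b" "t' \<le> b'" "\<And>k. (cstep ^^ t) (a @ k, T) = (k, T1)"
    "\<And>k. (cstep ^^ t') (c @ k, T1) = (k, T2)" using assms by (auto simp: exec_def)
  have "(cstep ^^ (t' + t)) ((a @ c) @ k, T) = (k, T2)" for k
    using t(3)[of "c @ k"] t(4) by (simp add: funpow_add)
  then show ?thesis unfolding exec_def using t by (intro exI[of _ "t' + t"]) auto
qed

lemma exec_step:
  assumes "\<And>k. cstep (cs @ k, T) = (cs' @ k, T1)" "exec cs' T1 b T2"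
  shows "exec cs T (Suc b) T2"
proof -
  obtain t where t: "t \<le> b" "\<And>k. (cstep ^^ t) (cs' @ k, T1) = (k, T2)" using assms by (auto simp: exec_def)
  then show ?thesis unfolding exec_def using assms(1)
    by (intro exI[of _ "Suc t"]) (simp add: funpow_Suc_right del: funpow.simps)
qed

lemma exec_Wr: "T i = (h, f) \<Longrightarrow> s \<le> 2 \<Longrightarrow> exec cs (T(i := (h, f(h := s)))) b T' \<Longrightarrow> exec (Wr i s # cs) T (Suc b) T'"
  by (erule exec_step[rotated]) (simp add: cstep_def)

lemma exec_Mv: "T i = (h, f) \<Longrightarrow> exec cs (T(i := (move d h, f))) b T' \<Longrightarrow> exec (Mv i d # cs) T (Suc b) T'"
  by (erule exec_step[rotated]) (simp add: cstep_def)

lemma exec_Cond: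
  "exec ((if tape_read (T i) = s then a else c) @ cs) T b T' \<Longrightarrow> exec (Cond i s a c # cs) T (Suc b) T'"
  by (erule exec_step[rotated]) (auto simp: cstep_def Let_def tape_act_read)

lemma exec_While_end: "tape_read (T i) \<in> S \<Longrightarrow> exec [While i S c] T 1 T"
  unfolding One_nat_def
  by (rule exec_step[where cs' = "[]" and ?T1.0 = T]) (auto simp: cstep_def Let_def tape_act_read exec_Nil)

lemma exec_While_step:
  assumes "tape_read (T i) \<notin> S" "exec c T b T1" "exec [While i S c] T1 b' T2"
  shows "exec [While i S c] T (Suc (b + b')) T2"
  by (rule exec_step[where cs' = "c @ [While i S c]" and ?T1.0 = T])
    (use assms in \<open>auto simp: cstep_def Let_def tape_act_read intro: exec_append\<close>)

lemma exec_While: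
  assumes "\<And>k. k < m \<Longrightarrow> tape_read (F k i) \<notin> S" "tape_read (F m i) \<in> S"
    and "\<And>k. k < m \<Longrightarrow> exec c (F k) b (F (Suc k))"
  shows "exec [While i S c] (F 0) (m * Suc b + 1) (F m)"
proof -
  \<comment> \<open>Induction on the number \<open>j\<close> of rounds still to come, with the
    terminating test as base case.\<close>
  have "exec [While i S c] (F (m - j)) (j * Suc b + 1) (F m)" if "j \<le> m" for j
    using that
  proof (induction j)
    case 0
    then show ?case using exec_While_end[of "F m" i S c] assms(2) by simp
  next
    case (Suc j)
    have "exec [While i S c] (F (m - Suc j)) (Suc (b + (j * Suc b + 1))) (F m)"
      by (rule exec_While_step)
        (use assms(1,3)[of "m - Suc j"] Suc in \<open>auto simp: Suc_diff_Suc\<close>)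
    then show ?case by (simp add: algebra_simps)
  qed
  from this[of m] show ?thesis by simp
qed

section \<open>Bounded loops over arrays\<close>

datatype loop =
    Skip
  | Set nat nat bool
  | Seq loop loop (infixr ";;" 60)
  | IfA nat nat loop loop
  | IfM nat nat loop loop
  | For nat loop

type_synonym env = "nat \<Rightarrow> nat"
type_synonym arrays = "nat \<Rightarrow> nat \<Rightarrow> bool"

fun sem :: "nat \<Rightarrow> (nat \<Rightarrow> nat \<Rightarrow> bool) \<Rightarrow> loop \<Rightarrow> env \<Rightarrow> arrays \<Rightarrow> arrays" where
  "sem n M Skip v A = A"
| "sem n M (Set a i b) v A = A(a := (A a)(v i := b))"
| "sem n M (Seq c d) v A = sem n M d v (sem n M c v A)"
| "sem n M (IfA a i c d) v A = (if A a (v i) then sem n M c v A else sem n M d v A)"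
| "sem n M (IfM i j c d) v A = (if M (v i) (v j) then sem n M c v A else sem n M d v A)"
| "sem n M (For i c) v A = fold (\<lambda>k. sem n M c (v(i := k))) [0..<n] A"

text \<open>Tapes \<open>1..K\<close> hold loop variables, the later ones arrays; \<open>X\<close> is the set of variables in whose
  scope the command stands. A variable that is not in \<open>X\<close> has the value 0.\<close>

fun wf_loop :: "nat \<Rightarrow> nat set \<Rightarrow> loop \<Rightarrow> bool" where
  "wf_loop K X Skip = True"
| "wf_loop K X (Set a i b) = (K < a \<and> i \<in> {1..K})"
| "wf_loop K X (Seq c d) = (wf_loop K X c \<and> wf_loop K X d)"
| "wf_loop K X (IfA a i c d) = (K < a \<and> i \<in> {1..K} \<and> wf_loop K X c \<and> wf_loop K X d)"
| "wf_loop K X (IfM i j c d) = (i \<noteq> j \<and> i \<in> {1..K} \<and> j \<in> {1..K} \<and> wf_loop K X c \<and> wf_loop K X d)"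
| "wf_loop K X (For i c) = (i \<in> {1..K} \<and> i \<notin> X \<and> wf_loop K (insert i X) c)"

text \<open>The left move before the first test lets the head start on the blank just right of the
  written cells, as it does after a full sweep.\<close>

definition rewind :: "nat \<Rightarrow> com list" where
  "rewind i = [Mv i Left, While i {0} [Mv i Left], Mv i Right]"

definition seek :: "nat \<Rightarrow> com list \<Rightarrow> com list" where
  "seek i c = [While i {2} (Mv i Right # c)]"

text \<open>Leaving cell \<open>m\<close> until the blank in cell -1 is read takes
  \<open>m + 1\<close> moves, so \<open>c\<close> runs once too often; \<open>d\<close> undoes the
  surplus.\<close>

definition unseek :: "nat \<Rightarrow> com list \<Rightarrow> com list \<Rightarrow> com list" where
  "unseek i c d = While i {0} (Mv i Left # c) # Mv i Right # d"

text \<open>Tape \<open>j\<close> is used as a ruler: whatever its value, it has \<open>n\<close>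
  nonblank cells, so tape 0 travels the length of one matrix row.\<close>

definition row :: "nat \<Rightarrow> dir \<Rightarrow> com list" where
  "row j d = While j {0} [Mv j Right, Mv 0 d] # rewind j"

text \<open>In conditionals the heads return inside the branches, because the entry must be tested
  before they leave it. \<open>For\<close> marks cell \<open>k\<close> with a 2 during round
  \<open>k\<close>; afterwards \<open>seek\<close> finds that cell again, the mark is erased and the
  head moves on.\<close>

fun compile :: "loop \<Rightarrow> com list" where
  "compile Skip = []"
| "compile (Set a i b) =
    seek i [Mv a Right] @ [Wr a (if b then 1 else 0)] @ unseek i [Mv a Left] [Mv a Right]"
| "compile (Seq c d) = compile c @ compile d"
| "compile (IfA a i c d) =
    seek i [Mv a Right] @
    [Cond a 1 (unseek i [Mv a Left] [Mv a Right] @ compile c) (unseek i [Mv a Left] [Mv a Right] @ compile d)]"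
| "compile (IfM i j c d) =
    (let back = unseek j [Mv 0 Left] [Mv 0 Right] @ unseek i (row j Left) (row j Right)
     in seek i (row j Right) @ seek j [Mv 0 Right] @
       [Cond 0 2 (back @ compile c) (back @ compile d)])"
| "compile (For i c) =
    Wr i 1 # While i {0} (Wr i 2 # rewind i @ compile c @ seek i [] @ [Wr i 1, Mv i Right]) #
      rewind i @ [Wr i 2]"

text \<open>Upper bounds, not all tight. A conditional pays for both branches, since the maximum of
  two polynomials need not be a polynomial.\<close>

fun cost :: "loop \<Rightarrow> nat poly" where
  "cost Skip = 0"
| "cost (Set a i b) = [:8, 6:]"
| "cost (Seq c d) = cost c + cost d"
| "cost (IfA a i c d) = [:8, 6:] + cost c + cost d"
| "cost (IfM i j c d) = [:16, 25, 10:] + cost c + cost d"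
| "cost (For i c) = [:0, 1:] * ([:8, 4:] + cost c) + [:6, 2:]"

text \<open>A loop variable with value \<open>m\<close> is a tape of \<open>n\<close> ones with a 2 in cell \<open>m\<close>. An array entry
  is reached by moving the heads of index and array in parallel up to the 2. Between commands all
  these heads rest on cell 0, so the tapes are a function of the store.\<close>

definition idx_cells :: "nat \<Rightarrow> nat \<Rightarrow> int \<Rightarrow> nat" where
  "idx_cells n m = (\<lambda>p. if p = int m then 2 else if 0 \<le> p \<and> p < int n then 1 else 0)"

definition rep :: "nat \<Rightarrow> nat \<Rightarrow> tape \<Rightarrow> env \<Rightarrow> arrays \<Rightarrow> tapes" where
  "rep K n tp v A = (\<lambda>t. if t = 0 then tp else if t \<le> K then (0, idx_cells n (v t))
     else (0, \<lambda>p. if 0 \<le> p \<and> A t (nat p) then 1 else 0))"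

section \<open>Correctness and running time of the compiled code\<close>

lemma exec_Cons: "exec [c] T b T1 \<Longrightarrow> exec cs T1 b' T2 \<Longrightarrow> exec (c # cs) T (b + b') T2"
  using exec_append[of "[c]"] by simp

lemma exec_Mv1: "T i = (h, f) \<Longrightarrow> exec [Mv i d] T 1 (T(i := (move d h, f)))"
  using exec_Mv exec_Nil by fastforce

lemma exec_Wr1: "T i = (h, f) \<Longrightarrow> s \<le> 2 \<Longrightarrow> exec [Wr i s] T 1 (T(i := (h, f(h := s))))"
  using exec_Wr exec_Nil by fastforce

lemma exec_rewind:
  assumes T: "T i = (int h, g)" and g: "g (-1) = 0" "\<And>p. 0 \<le> p \<Longrightarrow> p < int h \<Longrightarrow> g p \<noteq> 0"
  shows "exec (rewind i) T (2 * h + 3) (T(i := (0, g)))"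
proof -
  define F where "F k = T(i := (int h - 1 - int k, g))" for k
  have 1: "exec [Mv i Left] T 1 (F 0)" using exec_Mv1[of T i "int h" g Left] T by (simp add: F_def)
  have 2: "exec [While i {0} [Mv i Left]] (F 0) (h * Suc 1 + 1) (F h)"
  proof (rule exec_While)
    show "exec [Mv i Left] (F k) 1 (F (Suc k))" for k
      using exec_Mv1[of "F k" i "int h - 1 - int k" g Left] by (simp add: F_def algebra_simps)
  qed (use g in \<open>auto simp: F_def\<close>)
  have 3: "exec [Mv i Right] (F h) 1 (T(i := (0, g)))"
    using exec_Mv1[of "F h" i "-1" g Right] by (simp add: F_def)
  show ?thesis unfolding rewind_def
    by (rule exec_mono[OF exec_Cons[OF 1 exec_Cons[OF 2 3]]]) simp
qed

text \<open>The shift \<open>s\<close> of the companion tape \<open>t\<close> is 1 for an array,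
  \<open>n\<close> for a row of the matrix, and 0 where only the mark is to be found.\<close>

lemma exec_seek:
  assumes T: "T i = (0, g)" "T t = (q, f)" "t \<noteq> i"
    and g: "g (int m) = 2" "\<And>p. 0 \<le> p \<Longrightarrow> p < int m \<Longrightarrow> g p \<noteq> 2"
    and c: "\<And>p q. exec c (T(i := (p, g), t := (q, f))) b (T(i := (p, g), t := (q + s, f)))"
  shows "exec (seek i c) T (m * (b + 2) + 1) (T(i := (int m, g), t := (q + int m * s, f)))"
proof -
  define F where "F k = T(i := (int k, g), t := (q + int k * s, f))" for k
  have "exec [While i {2} (Mv i Right # c)] (F 0) (m * Suc (1 + b) + 1) (F m)"
  proof (rule exec_While)
    fix k
    have "exec [Mv i Right] (F k) 1 (T(i := (int (Suc k), g), t := (q + int k * s, f)))"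
      using exec_Mv1[of "F k" i "int k" g Right] T(3) by (simp add: F_def fun_upd_twist add.commute)
    from exec_Cons[OF this c] show "exec (Mv i Right # c) (F k) (1 + b) (F (Suc k))"
      by (simp add: F_def algebra_simps)
  qed (use g T in \<open>auto simp: F_def\<close>)
  moreover have "F 0 = T" using T by (auto simp: F_def)
  ultimately show ?thesis by (simp add: seek_def F_def)
qed

lemma exec_unseek:
  assumes T: "T i = (int m, g)" "T t = (q, f)" "t \<noteq> i"
    and g: "g (-1) = 0" "\<And>p. 0 \<le> p \<Longrightarrow> p \<le> int m \<Longrightarrow> g p \<noteq> 0"
    and c: "\<And>p q. exec c (T(i := (p, g), t := (q, f))) b (T(i := (p, g), t := (q - s, f)))"
    and d: "\<And>p q. exec d (T(i := (p, g), t := (q, f))) b (T(i := (p, g), t := (q + s, f)))"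
  shows "exec (unseek i c d) T (Suc m * (b + 2) + b + 2) (T(i := (0, g), t := (q - int m * s, f)))"
proof -
  define F where "F k = T(i := (int m - int k, g), t := (q - int k * s, f))" for k
  have "exec [While i {0} (Mv i Left # c)] (F 0) (Suc m * Suc (1 + b) + 1) (F (Suc m))"
  proof (rule exec_While)
    fix k
    have "exec [Mv i Left] (F k) 1 (T(i := (int m - int (Suc k), g), t := (q - int k * s, f)))"
      using exec_Mv1[of "F k" i "int m - int k" g Left] T(3) by (simp add: F_def fun_upd_twist algebra_simps)
    from exec_Cons[OF this c] show "exec (Mv i Left # c) (F k) (1 + b) (F (Suc k))"
      by (simp add: F_def algebra_simps)
  qed (use g T in \<open>auto simp: F_def\<close>)
  moreover have "F 0 = T" using T by (auto simp: F_def)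
  ultimately have 1: "exec [While i {0} (Mv i Left # c)] T (Suc m * Suc (1 + b) + 1) (F (Suc m))" by simp
  have 2: "exec [Mv i Right] (F (Suc m)) 1 (T(i := (0, g), t := (q - int (Suc m) * s, f)))"
    using exec_Mv1[of "F (Suc m)" i "-1" g Right] T(3) by (simp add: F_def fun_upd_twist)
  have 3: "exec d (T(i := (0, g), t := (q - int (Suc m) * s, f))) b (T(i := (0, g), t := (q - int m * s, f)))"
    using d[of 0 "q - int (Suc m) * s"] by (simp add: algebra_simps)
  show ?thesis unfolding unseek_def
    by (rule exec_mono[OF exec_Cons[OF 1 exec_Cons[OF 2 3]]]) simp
qed

lemma idx_cells:
  "idx_cells n m (int m) = 2" "p < int m \<Longrightarrow> idx_cells n m p \<noteq> 2" "idx_cells n m (-1) = 0"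
  "m < n \<Longrightarrow> 0 \<le> p \<Longrightarrow> p < int n \<Longrightarrow> idx_cells n m p \<noteq> 0" "m < n \<Longrightarrow> idx_cells n m (int n) = 0"
  by (auto simp: idx_cells_def)

lemma exec_seek_array:
  assumes "T i = (0, idx_cells n m)" "T a = (q, f)" "a \<noteq> i" "m < n"
  shows "exec (seek i [Mv a Right]) T (3 * n + 1) (T(i := (int m, idx_cells n m), a := (q + int m, f)))"
proof -
  have "exec (seek i [Mv a Right]) T (m * (1 + 2) + 1) (T(i := (int m, idx_cells n m), a := (q + int m * 1, f)))"
  proof (rule exec_seek[OF assms(1,2,3) idx_cells(1,2)])
    show "exec [Mv a Right] (T(i := (p, idx_cells n m), a := (q, f))) 1
        (T(i := (p, idx_cells n m), a := (q + 1, f)))" for p q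
      using exec_Mv1[of "T(i := (p, idx_cells n m), a := (q, f))" a q f Right] by simp
  qed
  then have "exec (seek i [Mv a Right]) T (m * (1 + 2) + 1) (T(i := (int m, idx_cells n m), a := (q + int m, f)))"
    by simp
  then show ?thesis by (rule exec_mono) (use assms(4) in simp)
qed

lemma exec_unseek_array:
  assumes "T i = (int m, idx_cells n m)" "T a = (q, f)" "a \<noteq> i" "m < n"
  shows "exec (unseek i [Mv a Left] [Mv a Right]) T (3 * n + 3) (T(i := (0, idx_cells n m), a := (q - int m, f)))"
proof -
  have "exec (unseek i [Mv a Left] [Mv a Right]) T (Suc m * (1 + 2) + 1 + 2)
     (T(i := (0, idx_cells n m), a := (q - int m * 1, f)))"
  proof (rule exec_unseek[OF assms(1,2,3) idx_cells(3)])
    show "exec [Mv a Right] (T(i := (p, idx_cells n m), a := (q, f))) 1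
        (T(i := (p, idx_cells n m), a := (q + 1, f)))" for p q
      using exec_Mv1[of "T(i := (p, idx_cells n m), a := (q, f))" a q f Right] by simp
    show "exec [Mv a Left] (T(i := (p, idx_cells n m), a := (q, f))) 1
        (T(i := (p, idx_cells n m), a := (q - 1, f)))" for p q
      using exec_Mv1[of "T(i := (p, idx_cells n m), a := (q, f))" a q f Left] by simp
  qed (use assms(4) idx_cells in auto)
  then have "exec (unseek i [Mv a Left] [Mv a Right]) T (Suc m * (1 + 2) + 1 + 2)
     (T(i := (0, idx_cells n m), a := (q - int m, f)))" by simp
  then show ?thesis by (rule exec_mono) (use assms(4) in simp)
qed

lemma exec_row:
  assumes T: "T j = (0, idx_cells n m)" "T 0 = (q, f)" "j \<noteq> 0" "m < n"
  shows "exec (row j d) T (5 * n + 4) (T(0 := (q + int n * (move d 0), f)))"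
proof -
  let ?g = "idx_cells n m"
  define F where "F k = T(j := (int k, ?g), 0 := (q + int k * (move d 0), f))" for k
  have mv: "move d h = h + move d 0" for h by (cases d) auto
  have "exec [While j {0} [Mv j Right, Mv 0 d]] (F 0) (n * Suc (1 + 1) + 1) (F n)"
  proof (rule exec_While)
    fix k
    have 1: "exec [Mv j Right] (F k) 1 (T(j := (int (Suc k), ?g), 0 := (q + int k * (move d 0), f)))" (is "exec _ _ _ ?T")
      using exec_Mv1[of "F k" j "int k" ?g Right] T(3) by (simp add: F_def fun_upd_twist add.commute)
    have 2: "exec [Mv 0 d] ?T 1 (F (Suc k))"
      using exec_Mv1[of ?T 0 "q + int k * (move d 0)" f d] by (simp add: F_def mv[of "q + int k * (move d 0)"] algebra_simps)
    show "exec [Mv j Right, Mv 0 d] (F k) (1 + 1) (F (Suc k))" by (rule exec_Cons[OF 1 2])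
  qed (use T idx_cells in \<open>auto simp: F_def\<close>)
  moreover have "F 0 = T" using T by (auto simp: F_def)
  ultimately have 1: "exec [While j {0} [Mv j Right, Mv 0 d]] T (n * Suc (1 + 1) + 1) (F n)" by simp
  have 2: "exec (rewind j) (F n) (2 * n + 3) ((F n)(j := (0, ?g)))"
    by (rule exec_rewind) (use T idx_cells in \<open>auto simp: F_def\<close>)
  have 3: "(F n)(j := (0, ?g)) = T(0 := (q + int n * (move d 0), f))"
    using T by (auto simp: F_def fun_upd_twist)
  show ?thesis unfolding row_def
    by (rule exec_mono[OF exec_Cons[OF 1 2[unfolded 3]]]) simp
qed

lemma exec_seek_row:
  assumes T: "T i = (0, idx_cells n m)" "T j = (0, idx_cells n l)" "T 0 = (q, f)" "i \<noteq> 0" "j \<noteq> 0" "i \<noteq> j"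
    and "m < n" "l < n"
  shows "exec (seek i (row j Right)) T (n * (5 * n + 6) + 1)
    (T(i := (int m, idx_cells n m), 0 := (q + int m * int n, f)))"
proof -
  have "exec (seek i (row j Right)) T (m * ((5 * n + 4) + 2) + 1)
    (T(i := (int m, idx_cells n m), 0 := (q + int m * int n, f)))"
  proof (rule exec_seek[OF T(1,3) _ idx_cells(1,2)])
    show "exec (row j Right) (T(i := (p, idx_cells n m), 0 := (q, f))) (5 * n + 4)
        (T(i := (p, idx_cells n m), 0 := (q + int n, f)))" for p q
      using exec_row[of "T(i := (p, idx_cells n m), 0 := (q, f))" j n l q f Right] assms by simp
  qed (use assms in auto)
  moreover have "m * (5 * n + 6) \<le> n * (5 * n + 6)"
    by (rule mult_le_mono1) (use assms in simp)
  ultimately show ?thesis by - (erule exec_mono, simp add: add.commute)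
qed

lemma exec_unseek_row:
  assumes T: "T i = (int m, idx_cells n m)" "T j = (0, idx_cells n l)" "T 0 = (q, f)" "i \<noteq> 0" "j \<noteq> 0" "i \<noteq> j"
    and "m < n" "l < n"
  shows "exec (unseek i (row j Left) (row j Right)) T (n * (5 * n + 6) + 5 * n + 6)
    (T(i := (0, idx_cells n m), 0 := (q - int m * int n, f)))"
proof -
  have "exec (unseek i (row j Left) (row j Right)) T (Suc m * ((5 * n + 4) + 2) + (5 * n + 4) + 2)
    (T(i := (0, idx_cells n m), 0 := (q - int m * int n, f)))"
  proof (rule exec_unseek[OF T(1,3) _ idx_cells(3)])
    show "exec (row j Right) (T(i := (p, idx_cells n m), 0 := (q, f))) (5 * n + 4)
        (T(i := (p, idx_cells n m), 0 := (q + int n, f)))" for p q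
      using exec_row[of "T(i := (p, idx_cells n m), 0 := (q, f))" j n l q f Right] assms by simp
    show "exec (row j Left) (T(i := (p, idx_cells n m), 0 := (q, f))) (5 * n + 4)
        (T(i := (p, idx_cells n m), 0 := (q - int n, f)))" for p q
      using exec_row[of "T(i := (p, idx_cells n m), 0 := (q, f))" j n l q f Left] assms by simp
  qed (use assms idx_cells in auto)
  \<comment> \<open>The surplus row is covered because \<open>m < n\<close>.\<close>
  moreover have "Suc m * (5 * n + 6) \<le> n * (5 * n + 6)"
    by (rule mult_le_mono1) (use assms in simp)
  ultimately show ?thesis by - (erule exec_mono, simp add: add.commute)
qed

text \<open>Tape 0 rests at \<open>off\<close>, the start of the matrix, between commands. Value 0
  outside \<open>X\<close> is what the closing write of \<open>For\<close> restores on the tape of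
  its variable, and \<open>v i < n\<close> makes \<open>n\<close> positive.\<close>

lemma exec_compile:
  assumes "wf_loop K X c" "\<And>i. i \<notin> X \<Longrightarrow> v i = 0" "\<And>i. v i < n"
  shows "exec (compile c) (rep K n (off, f) v A) (poly (cost c) n)
    (rep K n (off, f) v (sem n (\<lambda>i j. f (off + int i * int n + int j) = 2) c v A))"
  using assms
proof (induction c arbitrary: X v A)
  case Skip
  then show ?case by (simp add: exec_Nil)
next
  case (Seq c d)
  then show ?case by (auto intro!: exec_append)
next
  case (Set a i b)
  let ?T = "rep K n (off, f) v A" and ?g = "idx_cells n (v i)"
  let ?h = "\<lambda>p::int. if 0 \<le> p \<and> A a (nat p) then 1 else (0::nat)"
  let ?h' = "?h(int (v i) := if b then 1 else 0)"
  have ia: "?T i = (0, ?g)" "?T a = (0, ?h)" "a \<noteq> i" "v i < n" using Set by (auto simp: rep_def)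
  let ?T1 = "?T(i := (int (v i), ?g), a := (int (v i), ?h))"
  have 1: "exec (seek i [Mv a Right]) ?T (3 * n + 1) ?T1"
    using exec_seek_array[OF ia] by simp
  have 2: "exec [Wr a (if b then 1 else 0)] ?T1 1 (?T1(a := (int (v i), ?h')))"
    by (rule exec_Wr1) auto
  have 3: "exec (unseek i [Mv a Left] [Mv a Right]) (?T1(a := (int (v i), ?h'))) (3 * n + 3)
     (?T1(a := (int (v i), ?h'), i := (0, ?g), a := (int (v i) - int (v i), ?h')))"
    by (rule exec_unseek_array) (use ia in auto)
  have 4: "?T1(a := (int (v i), ?h'), i := (0, ?g), a := (int (v i) - int (v i), ?h')) = rep K n (off, f) v (A(a := (A a)(v i := b)))"
    using Set ia(3) by (auto simp: rep_def fun_eq_iff)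
  show ?case
    unfolding compile.simps sem.simps
    by (rule exec_mono[OF exec_append[OF 1 exec_append[OF 2 3[unfolded 4]]]]) simp
next
  case (IfA a i c d)
  let ?T = "rep K n (off, f) v A" and ?g = "idx_cells n (v i)"
  let ?h = "\<lambda>p::int. if 0 \<le> p \<and> A a (nat p) then 1 else (0::nat)"
  let ?s = "\<lambda>c. sem n (\<lambda>i j. f (off + int i * int n + int j) = 2) c v A"
  have ia: "?T i = (0, ?g)" "?T a = (0, ?h)" "a \<noteq> i" "v i < n" using IfA by (auto simp: rep_def)
  let ?T1 = "?T(i := (int (v i), ?g), a := (int (v i), ?h))"
  have 1: "exec (seek i [Mv a Right]) ?T (3 * n + 1) ?T1"
    using exec_seek_array[OF ia] by simp
  have "exec (unseek i [Mv a Left] [Mv a Right]) ?T1 (3 * n + 3) (?T1(i := (0, ?g), a := (int (v i) - int (v i), ?h)))"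
    by (rule exec_unseek_array) (use ia in auto)
  moreover have "?T1(i := (0, ?g), a := (int (v i) - int (v i), ?h)) = ?T" using ia by auto
  ultimately have 2: "exec (unseek i [Mv a Left] [Mv a Right]) ?T1 (3 * n + 3) ?T" by simp
  have c: "exec (compile c) ?T (poly (cost c) n) (rep K n (off, f) v (?s c))"
    by (rule IfA.IH(1)[of X]) (use IfA.prems in auto)
  have d: "exec (compile d) ?T (poly (cost d) n) (rep K n (off, f) v (?s d))"
    by (rule IfA.IH(2)[of X]) (use IfA.prems in auto)
  let ?b = "3 * n + 3 + poly (cost c) n + poly (cost d) n"
  have 3: "exec (unseek i [Mv a Left] [Mv a Right] @ compile c) ?T1 ?b (rep K n (off, f) v (?s c))"
    "exec (unseek i [Mv a Left] [Mv a Right] @ compile d) ?T1 ?b (rep K n (off, f) v (?s d))"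
    by (rule exec_mono[OF exec_append[OF 2 c]], simp) (rule exec_mono[OF exec_append[OF 2 d]], simp)
  have "exec [Cond a 1 (unseek i [Mv a Left] [Mv a Right] @ compile c) (unseek i [Mv a Left] [Mv a Right] @ compile d)]
     ?T1 (Suc ?b) (rep K n (off, f) v (?s (IfA a i c d)))"
    by (rule exec_Cond) (use 3 in auto)
  from exec_append[OF 1 this] show ?case
    unfolding compile.simps by (rule exec_mono) simp
next
  case (IfM i j c d)
  let ?T = "rep K n (off, f) v A" and ?g = "idx_cells n (v i)" and ?g' = "idx_cells n (v j)"
  let ?s = "\<lambda>c. sem n (\<lambda>i j. f (off + int i * int n + int j) = 2) c v A"
  have i: "?T i = (0, ?g)" "?T j = (0, ?g')" "?T 0 = (off, f)" "i \<noteq> 0" "j \<noteq> 0" "i \<noteq> j" "v i < n" "v j < n"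
    using IfM.prems by (auto simp: rep_def)
  let ?q = "off + int (v i) * int n"
  let ?T1 = "?T(i := (int (v i), ?g), 0 := (?q, f))"
  let ?T2 = "?T1(j := (int (v j), ?g'), 0 := (?q + int (v j), f))"
  have 1: "exec (seek i (row j Right)) ?T (n * (5 * n + 6) + 1) ?T1"
    by (rule exec_seek_row[OF i])
  have 2: "exec (seek j [Mv 0 Right]) ?T1 (3 * n + 1) ?T2"
    by (rule exec_seek_array) (use i in auto)
  have "exec (unseek j [Mv 0 Left] [Mv 0 Right]) ?T2 (3 * n + 3) (?T2(j := (0, ?g'), 0 := (?q + int (v j) - int (v j), f)))"
    by (rule exec_unseek_array) (use i in auto)
  moreover have "?T2(j := (0, ?g'), 0 := (?q + int (v j) - int (v j), f)) = ?T1" using i by auto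
  ultimately have 3: "exec (unseek j [Mv 0 Left] [Mv 0 Right]) ?T2 (3 * n + 3) ?T1" by simp
  have "exec (unseek i (row j Left) (row j Right)) ?T1 (n * (5 * n + 6) + 5 * n + 6)
      (?T1(i := (0, ?g), 0 := (?q - int (v i) * int n, f)))"
    by (rule exec_unseek_row[where l = "v j"]) (use i in auto)
  moreover have "?T1(i := (0, ?g), 0 := (?q - int (v i) * int n, f)) = ?T" using i by auto
  ultimately have 4: "exec (unseek i (row j Left) (row j Right)) ?T1 (n * (5 * n + 6) + 5 * n + 6) ?T" by simp
  let ?back = "unseek j [Mv 0 Left] [Mv 0 Right] @ unseek i (row j Left) (row j Right)"
  note 5 = exec_append[OF 3 4]
  have c: "exec (compile c) ?T (poly (cost c) n) (rep K n (off, f) v (?s c))"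
    by (rule IfM.IH(1)[of X]) (use IfM.prems in auto)
  have d: "exec (compile d) ?T (poly (cost d) n) (rep K n (off, f) v (?s d))"
    by (rule IfM.IH(2)[of X]) (use IfM.prems in auto)
  let ?b = "3 * n + 3 + (n * (5 * n + 6) + 5 * n + 6) + poly (cost c) n + poly (cost d) n"
  have 6: "exec (?back @ compile c) ?T2 ?b (rep K n (off, f) v (?s c))"
    "exec (?back @ compile d) ?T2 ?b (rep K n (off, f) v (?s d))"
    by (rule exec_mono[OF exec_append[OF 5 c]], simp) (rule exec_mono[OF exec_append[OF 5 d]], simp)
  have "exec [Cond 0 2 (?back @ compile c) (?back @ compile d)] ?T2 (Suc ?b) (rep K n (off, f) v (?s (IfM i j c d)))"
    by (rule exec_Cond) (use 6 in auto)
  from exec_append[OF 1 exec_append[OF 2 this]] show ?case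
    unfolding compile.simps Let_def by (rule exec_mono) (simp add: algebra_simps)
next
  case (For i c)
  let ?M = "\<lambda>i j. f (off + int i * int n + int j) = 2"
  let ?ones = "\<lambda>p::int. if 0 \<le> p \<and> p < int n then 1 else (0::nat)"
  \<comment> \<open>\<open>B k\<close> is the store after \<open>k\<close> rounds, and
    \<open>F k\<close> the tapes at that moment, with the head of tape \<open>i\<close> on cell
    \<open>k\<close> and no mark on it.\<close>
  define B where "B k = fold (\<lambda>k. sem n ?M c (v(i := k))) [0..<k] A" for k
  define F where "F k = (rep K n (off, f) v (B k))(i := (int k, ?ones))" for k
  let ?T = "rep K n (off, f) v"
  have i: "1 \<le> i" "i \<le> K" "i \<notin> X" and vi: "v i = 0" and n: "0 < n"
    using For.prems(2,3) For.prems(1) by (auto intro: le_less_trans[OF le0])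
  have Ti: "?T A' i = (0, idx_cells n 0)" for A' using i vi by (simp add: rep_def)
  have ones: "(idx_cells n k)(int k := 1) = ?ones" "?ones(int k := 2) = idx_cells n k" if "k < n" for k
    using that by (auto simp: idx_cells_def fun_eq_iff)
  have 1: "exec [Wr i 1] (?T A) 1 (F 0)"
    using exec_Wr1[of "?T A" i 0 "idx_cells n 0" 1] Ti ones(1)[of 0] n by (simp add: F_def B_def)
  let ?body = "Wr i 2 # rewind i @ compile c @ seek i [] @ [Wr i 1, Mv i Right]"
  have 2: "exec [While i {0} ?body] (F 0) (n * Suc (4 * n + 7 + poly (cost c) n) + 1) (F n)"
  proof (rule exec_While)
    fix k assume k: "k < n"
    show "tape_read (F k i) \<notin> {0}" using k by (simp add: F_def)
    let ?v = "v(i := k)"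
    let ?S = "rep K n (off, f) ?v"
    have S: "(?T A')(i := (0, idx_cells n k)) = ?S A'" for A' using i by (auto simp: rep_def)
    have Si: "?S A' i = (0, idx_cells n k)" for A' using i by (auto simp: rep_def)
    have a: "exec [Wr i 2] (F k) 1 ((?T (B k))(i := (int k, idx_cells n k)))"
      using exec_Wr1[of "F k" i "int k" ?ones 2] ones(2)[OF k] by (simp add: F_def)
    have "exec (rewind i) ((?T (B k))(i := (int k, idx_cells n k))) (2 * k + 3)
        ((?T (B k))(i := (int k, idx_cells n k), i := (0, idx_cells n k)))"
      by (rule exec_rewind) (use k idx_cells in auto)
    then have b: "exec (rewind i) ((?T (B k))(i := (int k, idx_cells n k))) (2 * k + 3) (?S (B k))"
      by (simp add: S)
    have c: "exec (compile c) (?S (B k)) (poly (cost c) n) (?S (B (Suc k)))"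
      unfolding B_def by (simp, rule For.IH[of "insert i X"]) (use For.prems k in auto)
    \<comment> \<open>\<open>exec_seek\<close> asks for a companion tape; tape 0 plays this part and
      stays where it is.\<close>
    obtain q h where qh: "?S (B (Suc k)) 0 = (q, h)" by fastforce
    have "exec (seek i []) (?S (B (Suc k))) (k * (0 + 2) + 1)
        ((?S (B (Suc k)))(i := (int k, idx_cells n k), 0 := (q + int k * 0, h)))"
      by (rule exec_seek[OF Si qh]) (use i idx_cells exec_Nil in auto)
    moreover have "(?S (B (Suc k)))(i := (int k, idx_cells n k), 0 := (q + int k * 0, h)) =
        (?T (B (Suc k)))(i := (int k, idx_cells n k))"
      using i qh by (auto simp: rep_def fun_eq_iff)
    ultimately have d: "exec (seek i []) (?S (B (Suc k))) (k * 2 + 1) ((?T (B (Suc k)))(i := (int k, idx_cells n k)))"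
      by (simp only: add_0)
    have e: "exec [Wr i 1] ((?T (B (Suc k)))(i := (int k, idx_cells n k))) 1 ((?T (B (Suc k)))(i := (int k, ?ones)))"
      using exec_Wr1[of "(?T (B (Suc k)))(i := (int k, idx_cells n k))" i "int k" "idx_cells n k" 1] ones(1)[OF k]
      by simp
    have f: "exec [Mv i Right] ((?T (B (Suc k)))(i := (int k, ?ones))) 1 (F (Suc k))"
      using exec_Mv1[of "(?T (B (Suc k)))(i := (int k, ?ones))" i "int k" ?ones Right]
      by (simp add: F_def add.commute)
    show "exec ?body (F k) (4 * n + 7 + poly (cost c) n) (F (Suc k))"
      by (rule exec_mono[OF exec_Cons[OF a exec_append[OF b exec_append[OF c exec_append[OF d exec_Cons[OF e f]]]]]])
        (use k in simp)
  qed (simp add: F_def)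
  have 3: "exec (rewind i) (F n) (2 * n + 3) ((F n)(i := (0, ?ones)))"
    by (rule exec_rewind) (auto simp: F_def)
  have 4: "exec [Wr i 2] ((F n)(i := (0, ?ones))) 1 (?T (B n))"
  proof -
    have "(?T (B n))(i := (0, idx_cells n 0)) = ?T (B n)" by (rule fun_upd_idem) (rule Ti)
    then show ?thesis
      using exec_Wr1[of "(F n)(i := (0, ?ones))" i 0 ?ones 2] ones(2)[of 0] n by (simp add: F_def)
  qed
  have "sem n ?M (For i c) v A = B n" by (simp add: B_def)
  with exec_Cons[OF 1 exec_Cons[OF 2 exec_append[OF 3 4]]] show ?case
    unfolding compile.simps by (simp only:) (erule exec_mono, simp add: algebra_simps)
qed

text \<open>Creates the tapes of the loop variables from the unary part of the input. If that part is
  empty, the final \<open>Wr i 2\<close> still produces a tape for \<open>n = 1\<close>.\<close>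

definition startup :: "nat \<Rightarrow> com list" where
  "startup K = While 0 (- {2}) (Mv 0 Right # concat (map (\<lambda>i. [Wr i 1, Mv i Right]) [1..<Suc K])) #
     Mv 0 Right # concat (map (\<lambda>i. rewind i @ [Wr i 2]) [1..<Suc K])"

lemma exec_concat_map:
  assumes "distinct ts"
    and "\<And>i T. i \<in> set ts \<Longrightarrow> P (T i) \<Longrightarrow> exec (code i) T b (T(i := g (T i)))"
    and "\<forall>i\<in>set ts. P (T i)"
  shows "exec (concat (map code ts)) T (length ts * b) (\<lambda>t. if t \<in> set ts then g (T t) else T t)"
  using assms
proof (induction ts arbitrary: T)
  case Nil
  then show ?case by (simp add: exec_Nil)
next
  case (Cons i ks)
  let ?T = "T(i := g (T i))"
  have 1: "exec (code i) T b ?T" by (rule Cons.prems(2)) (use Cons.prems(3) in auto)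
  have "exec (concat (map code ks)) ?T (length ks * b) (\<lambda>t. if t \<in> set ks then g (?T t) else ?T t)"
    by (rule Cons.IH) (use Cons.prems in auto)
  moreover have "(\<lambda>t. if t \<in> set ks then g (?T t) else ?T t) = (\<lambda>t. if t \<in> set (i # ks) then g (T t) else T t)"
    using Cons.prems(1) by (intro ext) auto
  ultimately have "exec (concat (map code ks)) ?T (length ks * b) (\<lambda>t. if t \<in> set (i # ks) then g (T t) else T t)"
    by (simp only:)
  from exec_append[OF 1 this] show ?case by simp
qed

definition ones :: "bool list \<Rightarrow> nat" where
  "ones x = length (takeWhile id x)"

lemma exec_startup:
  fixes x :: "bool list"
  defines "m \<equiv> ones x"
  shows "exec (startup K) (inp x) (m * (2 * K + 2) + 2 + K * (2 * m + 4))
    (rep K (max 1 m) (int m + 1, snd (input_tape x)) (\<lambda>_. 0) (\<lambda>_ _. False))"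
proof -
  let ?f = "snd (input_tape x)"
  let ?ones = "\<lambda>k p. if 0 \<le> p \<and> p < int k then 1 else (0::nat)"
  define ts where "ts = [1..<Suc K]"
  have ts: "set ts = {1..K}" "distinct ts" "length ts = K" by (auto simp: ts_def)
  let ?write = "concat (map (\<lambda>i. [Wr i 1, Mv i Right]) ts)"
  define F where "F k = (\<lambda>t::nat. if t = 0 then (int k, ?f) else if t \<le> K then (int k, ?ones k) else blank_tape)" for k
  have m: "m \<le> length x" by (simp add: m_def ones_def length_takeWhile_le)
  have one: "?f (int k) = 2" if "k < m" for k
    using that m nth_mem[of k "takeWhile id x"] set_takeWhileD[of "takeWhile id x ! k" id x]
    by (auto simp: input_tape_def m_def ones_def takeWhile_nth)
  \<comment> \<open>The first bit that is not one reads 1; if the input consists of ones only, the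
    blank 0 ends the loop.\<close>
  have not_one: "?f (int m) \<noteq> 2"
    using nth_length_takeWhile[of id x] by (auto simp: input_tape_def m_def ones_def)
  have 1: "exec [While 0 (- {2}) (Mv 0 Right # ?write)] (F 0) (m * Suc (1 + K * 2) + 1) (F m)"
  proof (rule exec_While)
    fix k
    let ?g = "\<lambda>(h, f). (h + 1, f(h := 1))"
    let ?T = "(F k)(0 := (int k + 1, ?f))"
    have "exec [Mv 0 Right] (F k) 1 ?T"
      using exec_Mv1[of "F k" 0 "int k" ?f Right] by (simp add: F_def)
    moreover have "exec ?write ?T (length ts * 2) (\<lambda>t. if t \<in> set ts then ?g (?T t) else ?T t)"
    proof (rule exec_concat_map[where P = "\<lambda>_. True"])
      fix i and T :: tapes
      obtain h f where T: "T i = (h, f)" by fastforce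
      show "exec [Wr i 1, Mv i Right] T 2 (T(i := ?g (T i)))"
        using exec_Cons[OF exec_Wr1[of T i h f 1] exec_Mv1[of "T(i := (h, f(h := 1)))" i h "f(h := 1)" Right]] T
        by (simp add: numeral_2_eq_2)
    qed (use ts in auto)
    moreover have "(\<lambda>t. if t \<in> set ts then ?g (?T t) else ?T t) = F (Suc k)"
      using ts(1) by (auto simp: F_def fun_eq_iff)
    ultimately show "exec (Mv 0 Right # ?write) (F k) (1 + K * 2) (F (Suc k))"
      using exec_Cons[of "Mv 0 Right" "F k" 1 ?T] by (simp only: ts)
  qed (use one not_one in \<open>auto simp: F_def\<close>)
  have F0: "F 0 = inp x" by (auto simp: F_def inp_def fun_eq_iff input_tape_def blank_tape_def)
  let ?T = "(F m)(0 := (int m + 1, ?f))"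
  have 2: "exec [Mv 0 Right] (F m) 1 ?T"
    using exec_Mv1[of "F m" 0 "int m" ?f Right] by (simp add: F_def)
  let ?g = "\<lambda>(h, f). (0, f(0 := 2))"
  have "exec (concat (map (\<lambda>i. rewind i @ [Wr i 2]) ts)) ?T (length ts * (2 * m + 4))
      (\<lambda>t. if t \<in> set ts then ?g (?T t) else ?T t)"
  proof (rule exec_concat_map[where P = "\<lambda>tp. tp = (int m, ?ones m)"])
    fix i and T :: tapes assume T: "T i = (int m, ?ones m)"
    have "exec (rewind i) T (2 * m + 3) (T(i := (0, ?ones m)))"
      by (rule exec_rewind) (use T in auto)
    from exec_append[OF this exec_Wr1[of "T(i := (0, ?ones m))" i 0 "?ones m" 2]] T
    show "exec (rewind i @ [Wr i 2]) T (2 * m + 4) (T(i := ?g (T i)))" by (simp add: add.commute)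
  qed (use ts in \<open>auto simp: F_def\<close>)
  moreover have "(\<lambda>t. if t \<in> set ts then ?g (?T t) else ?T t) =
      rep K (max 1 m) (int m + 1, ?f) (\<lambda>_. 0) (\<lambda>_ _. False)"
    using ts(1) by (auto simp: F_def rep_def fun_eq_iff idx_cells_def blank_tape_def)
  ultimately have 3: "exec (concat (map (\<lambda>i. rewind i @ [Wr i 2]) ts)) ?T (K * (2 * m + 4))
      (rep K (max 1 m) (int m + 1, ?f) (\<lambda>_. 0) (\<lambda>_ _. False))" by (simp only: ts)
  show ?thesis unfolding startup_def F0[symmetric] ts_def[symmetric]
    by (rule exec_mono[OF exec_Cons[OF 1 exec_Cons[OF 2 3]]]) simp
qed

lemma poly_nat_mono: "m \<le> n \<Longrightarrow> poly p m \<le> poly p (n::nat)"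
  by (induction p) (auto intro: add_mono mult_mono)

text \<open>On inputs that encode no graph the matrix has junk entries, but \<open>c\<close> still terminates.\<close>

theorem decide_by_loop:
  assumes c: "wf_loop K {} c" "K < r"
  defines "n \<equiv> \<lambda>x. max 1 (ones x)"
  defines "M \<equiv> \<lambda>x i j. snd (input_tape x) (int (ones x) + 1 + int i * int (n x) + int j) = 2"
  shows "\<exists>T. polytime_tm T \<and>
    (\<forall>x. accepts T x \<longleftrightarrow> \<not> sem (n x) (M x) c (\<lambda>_. 0) (\<lambda>_ _. False) r 0)"
proof -
  let ?cs = "startup K @ compile c @ [Cond r 1 [Rej] []]"
  \<comment> \<open>The first summand bounds the startup with \<open>length x\<close> in place of
    the number of leading ones, the second the loops, as \<open>n x\<close> is at most
    \<open>1 + length x\<close>, and the last is the final test.\<close>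
  let ?p = "[:2 + 4 * K, 4 * K + 2:] + pcompose (cost c) [:1, 1:] + 1"
  have "\<exists>t\<le>poly ?p (length x). fst ((cstep ^^ t) (?cs, inp x)) =
      (if \<not> sem (n x) (M x) c (\<lambda>_. 0) (\<lambda>_ _. False) r 0 then [] else [Rej])" for x
  proof -
    let ?m = "ones x" and ?L = "length x"
    let ?A = "sem (n x) (M x) c (\<lambda>_. 0) (\<lambda>_ _. False)"
    let ?tp = "(int ?m + 1, snd (input_tape x))"
    have m: "?m \<le> ?L" by (simp add: ones_def length_takeWhile_le)
    have 1: "exec (startup K) (inp x) (?m * (2 * K + 2) + 2 + K * (2 * ?m + 4))
      (rep K (n x) ?tp (\<lambda>_. 0) (\<lambda>_ _. False))"
      unfolding n_def by (rule exec_startup)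
    have 2: "exec (compile c) (rep K (n x) ?tp (\<lambda>_. 0) (\<lambda>_ _. False)) (poly (cost c) (n x))
       (rep K (n x) ?tp (\<lambda>_. 0) ?A)"
      unfolding M_def by (rule exec_compile[OF c(1)]) (auto simp: n_def)
    obtain t where t: "t \<le> ?m * (2 * K + 2) + 2 + K * (2 * ?m + 4) + poly (cost c) (n x)"
      "(cstep ^^ t) (?cs, inp x) = ([Cond r 1 [Rej] []], rep K (n x) ?tp (\<lambda>_. 0) ?A)"
      using exec_append[OF 1 2] unfolding exec_def append_assoc by blast
    have "poly (cost c) (n x) \<le> poly (cost c) (1 + ?L)" by (rule poly_nat_mono) (use m in \<open>simp add: n_def\<close>)
    moreover have "?m * (2 * K + 2) + 2 + K * (2 * ?m + 4) \<le> ?L * (2 * K + 2) + 2 + K * (2 * ?L + 4)"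
      by (intro add_mono mult_mono) (use m in auto)
    ultimately have "Suc t \<le> poly ?p ?L" using t(1) by (simp add: poly_pcompose algebra_simps)
    moreover have "fst ((cstep ^^ Suc t) (?cs, inp x)) = (if \<not> ?A r 0 then [] else [Rej])"
      unfolding funpow.simps o_apply t(2) using c(2) by (simp add: cstep_def rep_def Let_def)
    ultimately show ?thesis by blast
  qed
  from decide_by_com[OF this] show ?thesis by simp
qed

section \<open>Deciding unfrozenness\<close>

text \<open>Permits replacing the matrix read from the tape, meaningful only for indices below
  \<open>n\<close>, by the adjacency relation.\<close>

lemma sem_cong:
  assumes "\<And>i j. i < n \<Longrightarrow> j < n \<Longrightarrow> M i j = M' i j"
  shows "(\<And>i. v i < n) \<Longrightarrow> sem n M c v A = sem n M' c v A"
proof (induction c arbitrary: v A)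
  case (For i c)
  have "fold (\<lambda>k. sem n M c (v(i := k))) [0..<n] A = fold (\<lambda>k. sem n M' c (v(i := k))) [0..<n] A"
    by (rule fold_cong) (use For in \<open>auto intro!: ext For.IH\<close>)
  then show ?case by simp
qed (use assms in auto)

lemma fold_upt_eq:
  "A = S 0 \<Longrightarrow> (\<And>k. k < n \<Longrightarrow> f k (S k) = S (Suc k)) \<Longrightarrow> fold f [0..<n] A = S n"
proof -
  assume *: "A = S 0" "\<And>k. k < n \<Longrightarrow> f k (S k) = S (Suc k)"
  have "fold f [0..<m] A = S m" if "m \<le> n" for m using that * by (induction m) auto
  then show ?thesis by simp
qed

lemma fold_upt_inv:
  "P 0 A \<Longrightarrow> (\<And>k B. k < n \<Longrightarrow> P k B \<Longrightarrow> P (Suc k) (f k B)) \<Longrightarrow> P n (fold f [0..<n] A)"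
proof -
  assume *: "P 0 A" "\<And>k B. k < n \<Longrightarrow> P k B \<Longrightarrow> P (Suc k) (f k B)"
  have "P m (fold f [0..<m] A)" if "m \<le> n" for m using that * by (induction m) auto
  then show ?thesis by simp
qed

text \<open>Loop variables. The variable \<open>zv\<close> is never bound and keeps the value 0: an array indexed by
  it serves as a Boolean register.\<close>

abbreviation (input) "zv \<equiv> 2::nat"
abbreviation (input) "rv \<equiv> 1::nat"
abbreviation (input) "av \<equiv> 3::nat"
abbreviation (input) "bv \<equiv> 4::nat"
abbreviation (input) "xv \<equiv> 5::nat"
abbreviation (input) "yv \<equiv> 6::nat"

abbreviation (input) "dead \<equiv> 7::nat"
abbreviation (input) "unmarked \<equiv> 8::nat"
abbreviation (input) "matched \<equiv> 9::nat"
abbreviation (input) "twins \<equiv> 10::nat"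
abbreviation (input) "found \<equiv> 11::nat"
abbreviation (input) "larger \<equiv> 12::nat"
abbreviation (input) "smaller \<equiv> 13::nat"
abbreviation (input) "one \<equiv> 14::nat"
abbreviation (input) "two \<equiv> 15::nat"

definition alive :: "nat \<Rightarrow> arrays \<Rightarrow> nat set" where
  "alive n A = {i. i < n \<and> \<not> A dead i}"

text \<open>Private neighbourhoods are never stored; membership is recomputed from the matrix at
  each visit.\<close>

definition private_do :: "nat \<Rightarrow> nat \<Rightarrow> nat \<Rightarrow> loop \<Rightarrow> loop" where
  "private_do p q x c = IfA dead x Skip (IfM p x (IfM q x Skip c) Skip)"

definition check_twins :: "nat \<Rightarrow> nat \<Rightarrow> loop" where
  "check_twins p q = For xv (private_do p q xv (For yv (IfA dead yv Skip
     (IfM xv yv (IfM q yv Skip (Set twins zv False)) (IfM q yv (Set twins zv False) Skip)))))"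

definition match_one :: loop where
  "match_one = For yv (private_do bv av yv (IfA matched yv Skip (IfA found zv Skip
     (Set matched yv True ;; Set found zv True))))"

text \<open>Compares the cardinalities by greedily matching \<open>P\<close> into \<open>Q\<close>.\<close>

definition match :: loop where
  "match = For xv (Set matched xv False) ;; Set larger zv False ;;
     For xv (private_do av bv xv
       (Set found zv False ;; match_one ;; IfA found zv Skip (Set larger zv True)))"

text \<open>Run only after all of \<open>P\<close> has been matched. An unmatched vertex of
  \<open>Q\<close> then means \<open>card P < card Q\<close>, and the marks stay.\<close>

definition unmark :: loop where
  "unmark = Set smaller zv False ;;
     For yv (private_do bv av yv (IfA matched yv Skip (Set smaller zv True))) ;;
     IfA smaller zv Skip (For xv (private_do bv av xv (Set unmarked xv True)))"

definition delete :: loop where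
  "delete = For xv (private_do av bv xv (Set dead xv True))"

text \<open>Nothing happens if \<open>card P > card Q\<close>; the enclosing loops also visit the pair with \<open>a\<close>
  and \<open>b\<close> exchanged.\<close>

definition twin_step :: loop where
  "twin_step = IfA dead av Skip (IfA dead bv Skip (IfM av bv
     (Set twins zv True ;; check_twins av bv ;; check_twins bv av ;;
      IfA twins zv (match ;; IfA larger zv Skip (unmark ;; delete)) Skip) Skip))"

definition count_marked :: loop where
  "count_marked = Set one zv False ;; Set two zv False ;;
     For xv (IfA dead xv Skip (IfA unmarked xv Skip (IfA one zv (Set two zv True) (Set one zv True))))"

definition frozen_loop :: loop where
  "frozen_loop = For rv (For av (For bv twin_step)) ;; count_marked"

lemmas loop_defs = frozen_loop_def count_marked_def twin_step_def delete_def unmark_def match_def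
  match_one_def check_twins_def private_do_def

lemma wf_frozen_loop: "wf_loop 6 {} frozen_loop"
  by (simp add: loop_defs)

section \<open>Effect of the individual loops on the arrays\<close>

lemma sem_private_do:
  "v x < n \<Longrightarrow> sem n M (private_do p q x c) v A =
    (if v x \<in> private_nbs M (alive n A) (v p) (v q) then sem n M c v A else A)"
  by (auto simp: private_do_def private_nbs_def alive_def)

lemma alive_upd [simp]: "t \<noteq> dead \<Longrightarrow> alive n (A(t := f)) = alive n A"
  by (simp add: alive_def)

lemma sem_check_twins:
  assumes v: "v zv = 0" and pq: "p \<notin> {xv, yv}" "q \<notin> {xv, yv}"
  shows "sem n M (check_twins p q) v A = A(twins := (A twins)(0 := A twins 0 \<and>
      (\<forall>x\<in>private_nbs M (alive n A) (v p) (v q). \<forall>y\<in>alive n A. M x y = M (v q) y)))"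
proof -
  let ?H = "alive n A"
  let ?P = "private_nbs M ?H (v p) (v q)"
  let ?c = "IfA dead yv Skip (IfM xv yv (IfM q yv Skip (Set twins zv False)) (IfM q yv (Set twins zv False) Skip))"
  let ?S = "\<lambda>A B. A(twins := (A twins)(0 := A twins 0 \<and> B))"
  have inner: "sem n M (For yv ?c) (v(xv := x)) B = ?S B (\<forall>y<n. y \<in> alive n B \<longrightarrow> M x y = M (v q) y)"
    for x and B :: arrays
    unfolding sem.simps(6)
    by (rule fold_upt_eq[where S = "\<lambda>k. ?S B (\<forall>y<k. y \<in> alive n B \<longrightarrow> M x y = M (v q) y)"])
      (use v pq in \<open>auto simp: All_less_Suc alive_def fun_eq_iff\<close>)
  have "sem n M (check_twins p q) v A =
      ?S A (\<forall>x<n. x \<in> ?P \<longrightarrow> (\<forall>y<n. y \<in> ?H \<longrightarrow> M x y = M (v q) y))"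
    unfolding check_twins_def sem.simps(6)
  proof (rule fold_upt_eq[where S = "\<lambda>k. ?S A (\<forall>x<k. x \<in> ?P \<longrightarrow> (\<forall>y<n. y \<in> ?H \<longrightarrow> M x y = M (v q) y))"])
    fix k assume k: "k < n"
    show "sem n M (private_do p q xv (For yv ?c)) (v(xv := k)) (?S A (\<forall>x<k. x \<in> ?P \<longrightarrow> (\<forall>y<n. y \<in> ?H \<longrightarrow> M x y = M (v q) y)))
       = ?S A (\<forall>x<Suc k. x \<in> ?P \<longrightarrow> (\<forall>y<n. y \<in> ?H \<longrightarrow> M x y = M (v q) y))"
      using k pq by (subst sem_private_do) (auto simp: inner All_less_Suc fun_eq_iff simp del: sem.simps)
  qed auto
  moreover have "(\<forall>x<n. x \<in> ?P \<longrightarrow> (\<forall>y<n. y \<in> ?H \<longrightarrow> M x y = M (v q) y)) \<longleftrightarrow>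
      (\<forall>x\<in>?P. \<forall>y\<in>?H. M x y = M (v q) y)"
    by (auto simp: private_nbs_def alive_def)
  ultimately show ?thesis by simp
qed

text \<open>Which free vertex gets matched is left open, since only the number of matched vertices
  is used.\<close>

lemma sem_match_one:
  fixes v A n M
  assumes v: "v zv = 0" and found: "\<not> A found 0"
  defines "F \<equiv> {y \<in> private_nbs M (alive n A) (v bv) (v av). \<not> A matched y}"
  shows "sem n M match_one v A = A \<and> F = {} \<or>
    (\<exists>y\<in>F. sem n M match_one v A = A(matched := (A matched)(y := True), found := (A found)(0 := True)))"
proof -
  let ?Q = "private_nbs M (alive n A) (v bv) (v av)"
  define R where "R k B \<longleftrightarrow> B = A \<and> F \<inter> {..<k} = {} \<or>
    (\<exists>y\<in>F. B = A(matched := (A matched)(y := True), found := (A found)(0 := True)))" for k and B :: arrays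
  have "R n (sem n M match_one v A)"
    unfolding match_one_def sem.simps(6)
  proof (rule fold_upt_inv[where P = R])
    show "R 0 A" by (simp add: R_def)
    fix k B assume k: "k < n" and B: "R k B"
    have "alive n B = alive n A" using B by (auto simp: R_def)
    then show "R (Suc k) (sem n M (private_do bv av yv (IfA matched yv Skip (IfA found zv Skip
     (Set matched yv True ;; Set found zv True)))) (v(yv := k)) B)"
      using B k v found by (subst sem_private_do) (auto simp: R_def F_def lessThan_Suc)
  qed
  moreover have "F \<subseteq> {..<n}" by (auto simp: F_def private_nbs_def alive_def)
  ultimately show ?thesis by (auto simp: R_def)
qed

lemma sem_match:
  fixes v A n M
  defines "P \<equiv> private_nbs M (alive n A) (v av) (v bv)" and "Q \<equiv> private_nbs M (alive n A) (v bv) (v av)"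
  assumes v: "v zv = 0"
  obtains T fd where "sem n M match v A =
      A(matched := T, found := (A found)(0 := fd), larger := (A larger)(0 := card Q < card P))"
    "card P \<le> card Q \<Longrightarrow> (\<forall>y\<in>Q. T y) \<longleftrightarrow> card P = card Q"
proof -
  have fin: "finite P" "finite Q" and Pn: "P \<subseteq> {..<n}" and Qn: "Q \<subseteq> {..<n}"
    by (auto simp: P_def Q_def private_nbs_def alive_def intro: finite_subset[of _ "{..<n}"])
  define A0 where "A0 = A(matched := (\<lambda>x. if x < n then False else A matched x), larger := (A larger)(0 := False))"
  have clear: "sem n M (For xv (Set matched xv False)) v A = A(matched := (\<lambda>x. if x < n then False else A matched x))"
    unfolding sem.simps(6)
    by (rule fold_upt_eq[where S = "\<lambda>k. A(matched := (\<lambda>x. if x < k then False else A matched x))"])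
      (auto simp: fun_eq_iff less_Suc_eq)
  \<comment> \<open>Until \<open>larger\<close> is set, the matched vertices of \<open>Q\<close> are
    as many as the visited vertices of \<open>P\<close>; once it is set, \<open>Q\<close> is used up
    and more vertices of \<open>P\<close> than \<open>card Q\<close> have been visited.\<close>
  define R where "R k B \<longleftrightarrow> (\<exists>T fd lg. B = A(matched := T, found := (A found)(0 := fd), larger := (A larger)(0 := lg)) \<and>
     (if lg then {y\<in>Q. T y} = Q \<and> card Q < card (P \<inter> {..<k})
      else card {y\<in>Q. T y} = card (P \<inter> {..<k})))" for k and B :: arrays
  let ?body = "Set found zv False ;; match_one ;; IfA found zv Skip (Set larger zv True)"
  have "R n (fold (\<lambda>k. sem n M (private_do av bv xv ?body) (v(xv := k))) [0..<n] A0)"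
  proof (rule fold_upt_inv[where P = R])
    have "{y \<in> Q. A0 matched y} = {}" using Qn by (auto simp: A0_def)
    then have "card {y \<in> Q. A0 matched y} = card (P \<inter> {..<0})" by (simp only:) simp
    moreover have "A0 = A(matched := A0 matched, found := (A found)(0 := A found 0), larger := (A larger)(0 := False))"
      by (simp add: A0_def fun_eq_iff)
    ultimately show "R 0 A0" unfolding R_def
      by (intro exI[of _ "A0 matched"] exI[of _ "A found 0"] exI[of _ False]) simp
    fix k B assume k: "k < n" and "R k B"
    then obtain T fd lg where B: "B = A(matched := T, found := (A found)(0 := fd), larger := (A larger)(0 := lg))"
      and T: "if lg then {y\<in>Q. T y} = Q \<and> card Q < card (P \<inter> {..<k})
        else card {y\<in>Q. T y} = card (P \<inter> {..<k})" by (auto simp: R_def)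
    have alv: "alive n B = alive n A" by (simp add: B)
    show "R (Suc k) (sem n M (private_do av bv xv ?body) (v(xv := k)) B)"
    proof (cases "k \<in> P")
      case False
      then have "P \<inter> {..<Suc k} = P \<inter> {..<k}" by (auto simp: less_Suc_eq)
      with \<open>R k B\<close> have "R (Suc k) B" by (simp only: R_def)
      then show ?thesis using False k alv by (subst sem_private_do) (simp_all add: P_def)
    next
      case True
      have card: "card (P \<inter> {..<Suc k}) = Suc (card (P \<inter> {..<k}))"
      proof -
        have "P \<inter> {..<Suc k} = insert k (P \<inter> {..<k})" using True by (auto simp: less_Suc_eq)
        then show ?thesis by simp
      qed
      let ?B = "B(found := (B found)(0 := False))" and ?v = "v(xv := k)"
      have *: "sem n M (private_do av bv xv ?body) ?v B =
          sem n M (IfA found zv Skip (Set larger zv True)) ?v (sem n M match_one ?v ?B)"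
        using True k alv v by (subst sem_private_do) (auto simp: P_def)
      have Q: "{y \<in> private_nbs M (alive n ?B) (?v bv) (?v av). \<not> ?B matched y} = {y\<in>Q. \<not> T y}"
        by (auto simp: Q_def B)
      have "sem n M match_one ?v ?B = ?B \<and> {y\<in>Q. \<not> T y} = {} \<or>
         (\<exists>y\<in>{y\<in>Q. \<not> T y}. sem n M match_one ?v ?B =
            ?B(matched := (?B matched)(y := True), found := (?B found)(0 := True)))"
        using sem_match_one[where v = ?v and A = ?B and n = n and M = M] v unfolding Q by simp
      then consider (full) "sem n M match_one ?v ?B = ?B" "{y\<in>Q. \<not> T y} = {}"
        | (new) y where "y \<in> Q" "\<not> T y" "sem n M match_one ?v ?B =
            ?B(matched := (?B matched)(y := True), found := (?B found)(0 := True))" by blast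
      then show ?thesis
      proof cases
        case full
        then have "{y\<in>Q. T y} = Q" by auto
        then show ?thesis unfolding * full(1) R_def using T v card
          by (intro exI[of _ T] exI[of _ False] exI[of _ True]) (auto simp: B fun_eq_iff split: if_splits)
      next
        case new
        then have "\<not> lg" using T by (auto split: if_splits)
        have "{z\<in>Q. (T(y := True)) z} = insert y {z\<in>Q. T z}" using new by auto
        then have "card {z\<in>Q. (T(y := True)) z} = Suc (card {z\<in>Q. T z})" using new fin by simp
        then show ?thesis unfolding * new(3) R_def using T v card \<open>\<not> lg\<close>
          by (intro exI[of _ "T(y := True)"] exI[of _ True] exI[of _ False]) (auto simp: B fun_eq_iff)
      qed
    qed
  qed
  moreover have "sem n M match v A = fold (\<lambda>k. sem n M (private_do av bv xv ?body) (v(xv := k))) [0..<n] A0"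
    unfolding match_def sem.simps(3) clear by (simp add: v A0_def)
  ultimately have "R n (sem n M match v A)" by simp
  moreover have "P \<inter> {..<n} = P" using Pn by blast
  ultimately obtain T fd lg where B: "sem n M match v A = A(matched := T, found := (A found)(0 := fd), larger := (A larger)(0 := lg))"
    and T: "if lg then {y\<in>Q. T y} = Q \<and> card Q < card P else card {y\<in>Q. T y} = card P"
    by (auto simp only: R_def)
  \<comment> \<open>With this, \<open>larger\<close> cannot have stayed unset when
    \<open>card Q < card P\<close>: all of \<open>P\<close> would have partners in
    \<open>Q\<close>.\<close>
  have le: "card {y\<in>Q. T y} \<le> card Q" using fin by (auto intro: card_mono)
  have "lg \<longleftrightarrow> card Q < card P" using T le by (auto split: if_splits)
  moreover have "(\<forall>y\<in>Q. T y) \<longleftrightarrow> card P = card Q" if "card P \<le> card Q"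
  proof -
    have "card {y\<in>Q. T y} = card P" using T that by (auto split: if_splits)
    moreover have "card {y\<in>Q. T y} = card Q \<longleftrightarrow> {y\<in>Q. T y} = Q"
      using fin card_subset_eq[of Q "{y\<in>Q. T y}"] by auto
    ultimately show ?thesis by auto
  qed
  ultimately show ?thesis using that B by simp
qed

lemma sem_unmark:
  fixes v A n M
  defines "Q \<equiv> private_nbs M (alive n A) (v bv) (v av)"
  assumes v: "v zv = 0"
  obtains sm where "sem n M unmark v A = A(smaller := sm,
      unmarked := (\<lambda>x. A unmarked x \<or> (\<forall>y\<in>Q. A matched y) \<and> x \<in> Q))"
proof -
  let ?S = "\<lambda>k. A(smaller := (A smaller)(0 := \<exists>y<k. y \<in> Q \<and> \<not> A matched y))"
  have Qn: "x \<in> Q \<Longrightarrow> x < n" for x by (auto simp: Q_def private_nbs_def alive_def)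
  have 1: "fold (\<lambda>k. sem n M (private_do bv av yv (IfA matched yv Skip (Set smaller zv True))) (v(yv := k))) [0..<n]
      (A(smaller := (A smaller)(0 := False))) = ?S n"
  proof (rule fold_upt_eq[where S = ?S])
    fix k assume "k < n"
    then show "sem n M (private_do bv av yv (IfA matched yv Skip (Set smaller zv True))) (v(yv := k)) (?S k) = ?S (Suc k)"
      by (subst sem_private_do) (auto simp: v Q_def fun_eq_iff Ex_less_Suc)
  qed simp
  let ?U = "\<lambda>k. (?S n)(unmarked := (\<lambda>x. A unmarked x \<or> x < k \<and> x \<in> Q))"
  have 2: "fold (\<lambda>k. sem n M (private_do bv av xv (Set unmarked xv True)) (v(xv := k))) [0..<n] (?S n) = ?U n"
  proof (rule fold_upt_eq[where S = ?U])
    fix k assume "k < n"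
    then show "sem n M (private_do bv av xv (Set unmarked xv True)) (v(xv := k)) (?U k) = ?U (Suc k)"
      by (subst sem_private_do) (auto simp: Q_def fun_eq_iff less_Suc_eq)
  qed (auto simp: fun_eq_iff)
  have "sem n M unmark v A = (if \<exists>y\<in>Q. \<not> A matched y then ?S n else ?U n)"
    unfolding unmark_def using 1 2 Qn by (auto simp: v)
  then show ?thesis
  proof (cases "\<exists>y\<in>Q. \<not> A matched y")
    case True
    then have "sem n M unmark v A = A(smaller := ?S n smaller,
      unmarked := (\<lambda>x. A unmarked x \<or> (\<forall>y\<in>Q. A matched y) \<and> x \<in> Q))"
      using \<open>sem n M unmark v A = _\<close> by (auto simp: fun_eq_iff)
    then show ?thesis using that by blast
  next
    case False
    then have "sem n M unmark v A = A(smaller := ?S n smaller,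
      unmarked := (\<lambda>x. A unmarked x \<or> (\<forall>y\<in>Q. A matched y) \<and> x \<in> Q))"
      using \<open>sem n M unmark v A = _\<close> Qn by (auto simp: fun_eq_iff)
    then show ?thesis using that by blast
  qed
qed

lemma sem_delete:
  "sem n M delete v A = A(dead := (\<lambda>x. A dead x \<or> x \<in> private_nbs M (alive n A) (v av) (v bv)))"
proof -
  let ?P = "private_nbs M (alive n A) (v av) (v bv)"
  let ?S = "\<lambda>k. A(dead := (\<lambda>x. A dead x \<or> x < k \<and> x \<in> ?P))"
  have "sem n M delete v A = ?S n"
    unfolding delete_def sem.simps(6)
  proof (rule fold_upt_eq[where S = ?S])
    fix k assume k: "k < n"
    \<comment> \<open>Deleting during the sweep is harmless: membership of \<open>k\<close> depends
      only on its own flag, which no earlier round touches.\<close>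
    have "k \<in> private_nbs M (alive n (?S k)) (v av) (v bv) \<longleftrightarrow> k \<in> ?P"
      by (auto simp: private_nbs_def alive_def)
    then show "sem n M (private_do av bv xv (Set dead xv True)) (v(xv := k)) (?S k) = ?S (Suc k)"
      using k by (subst sem_private_do) (auto simp: fun_eq_iff less_Suc_eq)
  qed (auto simp: fun_eq_iff)
  moreover have "x < n" if "x \<in> ?P" for x using that by (auto simp: private_nbs_def alive_def)
  ultimately show ?thesis by (auto simp: fun_eq_iff)
qed

text \<open>Only \<open>dead\<close> and \<open>unmarked\<close> carry information from one pair to
  the next; all other arrays are scratch and left unspecified.\<close>

lemma sem_twin_step:
  fixes v A n M
  defines "P \<equiv> private_nbs M (alive n A) (v av) (v bv)" and "Q \<equiv> private_nbs M (alive n A) (v bv) (v av)"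
  assumes v: "v zv = 0" "v av < n" "v bv < n"
  defines "go \<equiv> twin_pair M (alive n A) (v av) (v bv) \<and> card P \<le> card Q"
  shows "sem n M twin_step v A dead = (\<lambda>x. A dead x \<or> go \<and> x \<in> P)"
    and "sem n M twin_step v A unmarked = (\<lambda>x. A unmarked x \<or> go \<and> card P = card Q \<and> x \<in> Q)"
proof -
  let ?H = "alive n A"
  have "sem n M twin_step v A dead = (\<lambda>x. A dead x \<or> go \<and> x \<in> P) \<and>
    sem n M twin_step v A unmarked = (\<lambda>x. A unmarked x \<or> go \<and> card P = card Q \<and> x \<in> Q)"
  proof (cases "v av \<in> ?H \<and> v bv \<in> ?H \<and> M (v av) (v bv)")
    case False
    then have "\<not> go" by (auto simp: go_def twin_pair_def)
    moreover have "sem n M twin_step v A = A" using False v by (auto simp: twin_step_def alive_def)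
    ultimately show ?thesis by simp
  next
    case True
    let ?tp = "twin_pair M ?H (v av) (v bv)"
    let ?A = "A(twins := (A twins)(0 := ?tp))"
    let ?c = "IfA twins zv (match ;; IfA larger zv Skip (unmark ;; delete)) Skip"
    have "sem n M twin_step v A = sem n M (Set twins zv True ;; check_twins av bv ;; check_twins bv av ;; ?c) v A"
      using True by (simp add: twin_step_def alive_def)
    also have "\<dots> = sem n M ?c v ?A"
      using True by (simp add: sem_check_twins v twin_pair_def)
    finally have 1: "sem n M twin_step v A = sem n M ?c v ?A" .
    show ?thesis
    proof (cases ?tp)
      case False
      then show ?thesis unfolding 1 by (simp add: go_def v)
    next
      case tp: True
      have PA: "private_nbs M (alive n ?A) (v av) (v bv) = P" "private_nbs M (alive n ?A) (v bv) (v av) = Q"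
        by (simp_all add: P_def Q_def)
      obtain T fd where m: "sem n M match v ?A =
          ?A(matched := T, found := (?A found)(0 := fd), larger := (?A larger)(0 := card Q < card P))"
        "card P \<le> card Q \<Longrightarrow> (\<forall>y\<in>Q. T y) \<longleftrightarrow> card P = card Q"
        using sem_match[where v = v and A = ?A and n = n and M = M, unfolded PA] v(1) by blast
      define B where "B = sem n M match v ?A"
      note m = m[folded B_def]
      have alB: "alive n B = ?H" unfolding m(1) by simp
      have "B larger 0 \<longleftrightarrow> card Q < card P" unfolding m(1) by simp
      then have 2: "sem n M twin_step v A = (if card Q < card P then B else sem n M delete v (sem n M unmark v B))"
        unfolding 1 using tp v(1) by (simp add: B_def)
      show ?thesis
      proof (cases "card Q < card P")
        case True
        then show ?thesis unfolding 2 m(1) by (auto simp: go_def)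
      next
        case False
        obtain sm where u: "sem n M unmark v B = B(smaller := sm,
            unmarked := (\<lambda>x. B unmarked x \<or> (\<forall>y\<in>Q. B matched y) \<and> x \<in> Q))"
          using sem_unmark[where v = v and A = B and n = n and M = M] v(1) unfolding alB Q_def by blast
        have Bm: "B matched = T" "B unmarked = A unmarked" "B dead = A dead" unfolding m(1) by simp_all
        have "sem n M twin_step v A = sem n M delete v (B(smaller := sm,
            unmarked := (\<lambda>x. A unmarked x \<or> card P = card Q \<and> x \<in> Q)))"
          unfolding 2 u using False m(2) by (simp add: Bm)
        then show ?thesis using tp False by (simp add: sem_delete alB Bm go_def P_def)
      qed
    qed
  qed
  then show "sem n M twin_step v A dead = (\<lambda>x. A dead x \<or> go \<and> x \<in> P)"
    and "sem n M twin_step v A unmarked = (\<lambda>x. A unmarked x \<or> go \<and> card P = card Q \<and> x \<in> Q)" by blast+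
qed

lemma sem_count_marked:
  assumes v: "v zv = 0"
  shows "sem n M count_marked v A two 0 \<longleftrightarrow> 2 \<le> card {x \<in> alive n A. \<not> A unmarked x}"
proof -
  let ?C = "\<lambda>k. {x \<in> alive n A. \<not> A unmarked x \<and> x < k}"
  define R where "R k B \<longleftrightarrow> B dead = A dead \<and> B unmarked = A unmarked \<and>
     (B one 0 \<longleftrightarrow> 1 \<le> card (?C k)) \<and> (B two 0 \<longleftrightarrow> 2 \<le> card (?C k))" for k and B :: arrays
  have "R n (sem n M count_marked v A)"
    unfolding count_marked_def sem.simps(3,6)
  proof (rule fold_upt_inv[where P = R])
    fix k B assume k: "k < n" and B: "R k B"
    have "?C (Suc k) = (if \<not> A dead k \<and> \<not> A unmarked k then insert k (?C k) else ?C k)"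
      using k by (auto simp: alive_def less_Suc_eq)
    moreover have "finite (?C k)" by (auto simp: alive_def)
    ultimately have "card (?C (Suc k)) = (if \<not> A dead k \<and> \<not> A unmarked k then Suc (card (?C k)) else card (?C k))"
      by simp
    then show "R (Suc k) (sem n M (IfA dead xv Skip (IfA unmarked xv Skip
        (IfA one zv (Set two zv True) (Set one zv True)))) (v(xv := k)) B)"
      using B v by (auto simp: R_def)
  qed (auto simp: R_def v)
  moreover have "?C n = {x \<in> alive n A. \<not> A unmarked x}" by (auto simp: alive_def)
  ultimately show ?thesis by (simp add: R_def)
qed

text \<open>The sets \<open>Q\<close> subtracted by the equality case of \<open>core_delete\<close>
  accumulate in \<open>unmarked\<close>, whether or not their vertices are deleted later.\<close>

definition core_inv :: "(nat \<Rightarrow> nat \<Rightarrow> bool) \<Rightarrow> nat \<Rightarrow> arrays \<Rightarrow> bool" where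
  "core_inv M n A \<longleftrightarrow> core M {..<n} = core M (alive n A) - {x. A unmarked x}"

lemma alive_twin_step:
  assumes v: "v zv = 0" "v av < n" "v bv < n"
  shows "alive n (sem n M twin_step v A) = alive n A -
    (if twin_pair M (alive n A) (v av) (v bv) \<and>
        card (private_nbs M (alive n A) (v av) (v bv)) \<le> card (private_nbs M (alive n A) (v bv) (v av))
     then private_nbs M (alive n A) (v av) (v bv) else {})"
  unfolding alive_def[of n "sem n M twin_step v A"] sem_twin_step[OF v] by (auto simp: alive_def)

lemma core_inv_twin_step:
  assumes "symp M" and v: "v zv = 0" "v av < n" "v bv < n" and inv: "core_inv M n A"
  shows "core_inv M n (sem n M twin_step v A)"
proof -
  let ?H = "alive n A" and ?P = "private_nbs M (alive n A) (v av) (v bv)"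
    and ?Q = "private_nbs M (alive n A) (v bv) (v av)"
  have fin: "finite ?H" by (simp add: alive_def)
  show ?thesis
  proof (cases "twin_pair M ?H (v av) (v bv) \<and> card ?P \<le> card ?Q")
    case True
    have "core M ?H = (if card ?P < card ?Q then core M (?H - ?P) else core M (?H - ?P) - ?Q)"
      by (rule core_delete) (use fin assms True in auto)
    then show ?thesis
      using inv True unfolding core_inv_def alive_twin_step[OF v] sem_twin_step(2)[OF v] by auto
  next
    case False
    then have "alive n (sem n M twin_step v A) = ?H" "sem n M twin_step v A unmarked = A unmarked"
      unfolding alive_twin_step[OF v] sem_twin_step(2)[OF v] by auto
    then show ?thesis using inv by (simp add: core_inv_def)
  qed
qed

section \<open>Progress of the rounds\<close>

lemma fold_decreasing:
  fixes h :: "'b \<Rightarrow> 'c set"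
  assumes "\<And>x B. x \<in> set xs \<Longrightarrow> h (g x B) \<subseteq> h B"
  shows "h (fold g xs A) \<subseteq> h A"
  using assms
proof (induction xs arbitrary: A)
  case (Cons x xs)
  have "h (fold g xs (g x A)) \<subseteq> h (g x A)" by (rule Cons.IH) (simp add: Cons.prems)
  also have "\<dots> \<subseteq> h A" by (simp add: Cons.prems)
  finally show ?case by simp
qed simp

text \<open>The step at \<open>y\<close> has to shrink only states on which nothing has been lost
  yet. Pairs visited earlier in a round may destroy the twin pair in question, but then they have
  already deleted something.\<close>

lemma fold_strictly_decreasing:
  fixes h :: "'b \<Rightarrow> 'c set"
  assumes "\<And>x B. x \<in> set xs \<Longrightarrow> h (g x B) \<subseteq> h B"
    and "y \<in> set xs" "\<And>B. h B = h A \<Longrightarrow> h (g y B) \<subset> h B"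
  shows "h (fold g xs A) \<subset> h A"
  using assms
proof (induction xs arbitrary: A)
  case (Cons x xs)
  have le: "h (fold g xs (g x A)) \<subseteq> h (g x A)" by (rule fold_decreasing[where h = h]) (simp add: Cons.prems)
  have le': "h (g x A) \<subseteq> h A" by (simp add: Cons.prems)
  show ?case
  proof (cases "h (g x A) = h A")
    case False
    then show ?thesis using le le' by auto
  next
    case True
    then have "y \<noteq> x" using Cons.prems(3)[of A] by auto
    then have "h (fold g xs (g x A)) \<subset> h (g x A)"
      by (intro Cons.IH) (use Cons.prems True in auto)
    then show ?thesis using True by simp
  qed
qed simp

lemma twin_round:
  fixes v A n M
  assumes v: "v zv = 0" and sym: "symp M" and irr: "irreflp M"
  defines "step \<equiv> \<lambda>i j. sem n M twin_step (v(av := i, bv := j))"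
  defines "rnd \<equiv> fold (\<lambda>i. fold (step i) [0..<n]) [0..<n]"
  shows "sem n M (For av (For bv twin_step)) v A = rnd A"
    and "alive n (rnd A) \<subseteq> alive n A"
    and "core_inv M n A \<Longrightarrow> core_inv M n (rnd A)"
    and "twin_pair M (alive n A) i j \<Longrightarrow> alive n (rnd A) \<subset> alive n A"
proof -
  show "sem n M (For av (For bv twin_step)) v A = rnd A"
  proof -
    have "sem n M (For bv twin_step) w = fold (\<lambda>j. sem n M twin_step (w(bv := j))) [0..<n]" for w
      by (rule ext) simp
    then show ?thesis by (simp add: rnd_def step_def)
  qed
  have dec: "alive n (step i j B) \<subseteq> alive n B" if "i < n" "j < n" for i j B
    unfolding step_def using that by (subst alive_twin_step) (auto simp: v)
  have dec': "alive n (fold (step i) [0..<n] B) \<subseteq> alive n B" if "i < n" for i B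
    by (rule fold_decreasing[where h = "alive n"]) (use dec that in auto)
  show "alive n (rnd A) \<subseteq> alive n A"
    unfolding rnd_def by (rule fold_decreasing[where h = "alive n"]) (use dec' in auto)
  show "core_inv M n A \<Longrightarrow> core_inv M n (rnd A)"
    unfolding rnd_def
  proof (rule fold_upt_inv[where P = "\<lambda>_. core_inv M n"])
    fix i B assume i: "i < n" and "core_inv M n B"
    then show "core_inv M n (fold (step i) [0..<n] B)"
    proof (elim fold_upt_inv[where P = "\<lambda>_. core_inv M n"])
      fix j B assume "j < n" "core_inv M n B"
      then show "core_inv M n (step i j B)"
        unfolding step_def by (intro core_inv_twin_step sym) (use i v in auto)
    qed
  qed
  have go: "alive n (rnd A) \<subset> alive n A" if tp: "twin_pair M (alive n A) i j"
    and le: "card (private_nbs M (alive n A) i j) \<le> card (private_nbs M (alive n A) j i)" for i j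
  proof -
    have ij: "i < n" "j < n" "j \<in> alive n A" "M i j" using tp by (auto simp: twin_pair_def alive_def)
    \<comment> \<open>By irreflexivity \<open>j\<close> itself is a private neighbour of
      \<open>i\<close>, so the deleted set is nonempty and the decrease strict.\<close>
    then have j: "j \<in> private_nbs M (alive n A) i j" using irr by (auto simp: private_nbs_def irreflp_def)
    have step: "alive n (step i j B) \<subset> alive n B" if "alive n B = alive n A" for B
      unfolding step_def by (subst alive_twin_step) (use ij v tp le j that in auto)
    have inner: "alive n (fold (step i) [0..<n] B) \<subset> alive n B" if "alive n B = alive n A" for B
      by (rule fold_strictly_decreasing[where h = "alive n" and y = j]) (use that ij dec step in auto)
    show ?thesis
      unfolding rnd_def by (rule fold_strictly_decreasing[where h = "alive n" and y = i]) (use ij dec' inner in auto)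
  qed
  show "alive n (rnd A) \<subset> alive n A" if tp: "twin_pair M (alive n A) i j"
    using go[OF tp] go[OF twin_pair_swap[OF sym tp]] by (meson nle_le)
qed

lemma sem_frozen_loop:
  assumes sym: "symp M" and irr: "irreflp M" and v: "v zv = 0"
    and twins: "\<And>H i j. H \<subseteq> {..<n} \<Longrightarrow> i \<in> H \<Longrightarrow> j \<in> H \<Longrightarrow> M i j \<Longrightarrow> \<exists>a b. twin_pair M H a b"
  shows "sem n M frozen_loop v (\<lambda>_ _. False) two 0 \<longleftrightarrow> 2 \<le> card (core M {..<n})"
proof -
  let ?A = "\<lambda>_ _. False"
  \<comment> \<open>Each round either starts without edges or loses a vertex. After \<open>n\<close>
    rounds the second alternative leaves no vertex, hence no edge either.\<close>
  define R where "R k B \<longleftrightarrow> core_inv M n B \<and>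
    ((\<forall>i\<in>alive n B. \<forall>j\<in>alive n B. \<not> M i j) \<or> card (alive n B) + k \<le> n)" for k B
  let ?B = "sem n M (For rv (For av (For bv twin_step))) v ?A"
  have alive_n: "alive n B \<subseteq> {..<n}" and fin: "finite (alive n B)" for B by (auto simp: alive_def)
  have "R n ?B"
    unfolding sem.simps(6)[of n M rv]
  proof (rule fold_upt_inv[where P = R])
    have "alive n ?A = {..<n}" by (auto simp: alive_def)
    then show "R 0 ?A" by (simp add: R_def core_inv_def)
    fix k B assume R: "R k B"
    let ?v = "v(rv := k)"
    let ?B' = "sem n M (For av (For bv twin_step)) ?v B"
    have v': "?v zv = 0" using v by simp
    note rnd = twin_round[where v = ?v and M = M and n = n and A = B, OF v' sym irr]
    have sub: "alive n ?B' \<subseteq> alive n B" unfolding rnd(1) by (rule rnd(2))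
    have inv: "core_inv M n ?B'" unfolding rnd(1) by (rule rnd(3)) (use R in \<open>simp add: R_def\<close>)
    show "R (Suc k) ?B'"
    proof (cases "\<forall>i\<in>alive n B. \<forall>j\<in>alive n B. \<not> M i j")
      case True
      then show ?thesis using sub inv unfolding R_def by blast
    next
      case False
      then obtain a b where "twin_pair M (alive n B) a b" using twins[OF alive_n[of B]] by blast
      then have "alive n ?B' \<subset> alive n B" unfolding rnd(1) by (rule rnd(4))
      then have "card (alive n ?B') < card (alive n B)" using fin psubset_card_mono by blast
      then show ?thesis using False R inv unfolding R_def by auto
    qed
  qed
  then have inv: "core_inv M n ?B" and "(\<forall>i\<in>alive n ?B. \<forall>j\<in>alive n ?B. \<not> M i j) \<or> card (alive n ?B) + n \<le> n"
    unfolding R_def by blast+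
  then have "\<forall>i\<in>alive n ?B. \<forall>j\<in>alive n ?B. \<not> M i j" using fin[of ?B] by (auto simp del: sem.simps)
  then have "core M (alive n ?B) = alive n ?B" using fin by (intro core_edgeless) blast+
  then have "core M {..<n} = {x \<in> alive n ?B. \<not> ?B unmarked x}" using inv unfolding core_inv_def by blast
  moreover have "sem n M frozen_loop v ?A = sem n M count_marked v ?B"
    unfolding frozen_loop_def sem.simps(3) ..
  ultimately show ?thesis using sem_count_marked[of v n M ?B, OF v] by (simp only:)
qed

section \<open>Reading the graph off its encoding\<close>

lemma encode_ones: "ones (encode vs G) = length vs"
  by (simp add: ones_def encode_def takeWhile_append)

lemma nth_concat_rows:
  "i < length us \<Longrightarrow> j < m \<Longrightarrow> (\<And>u. u \<in> set us \<Longrightarrow> length (f u) = m) \<Longrightarrow>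
    concat (map f us) ! (i * m + j) = f (us ! i) ! j"
proof (induction us arbitrary: i)
  case (Cons u us)
  then show ?case by (cases i) (auto simp: nth_append add.assoc)
qed simp

lemma encode_matrix:
  assumes "i < length vs" "j < length vs"
  defines "n \<equiv> length vs"
  shows "snd (input_tape (encode vs G)) (int n + 1 + int i * int n + int j) = 2 \<longleftrightarrow> adjacent G (vs ! i) (vs ! j)"
proof -
  let ?row = "\<lambda>u. map (\<lambda>v. {u, v} \<in> edges G) vs"
  have eq: "int n + 1 + int i * int n + int j = int (Suc n + (i * n + j))" by simp
  have "i * n + j < Suc i * n" using assms by simp
  also have "\<dots> \<le> n * n" using assms by (intro mult_le_mono1) simp
  finally have "i * n + j < n * n" .
  moreover have "length (concat (map ?row vs)) = n * n"
    by (simp add: length_concat n_def comp_def sum_list_triv)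
  ultimately have "Suc n + (i * n + j) < length (encode vs G)" by (simp add: encode_def n_def)
  moreover have "encode vs G ! (Suc n + (i * n + j)) = adjacent G (vs ! i) (vs ! j)"
    using nth_concat_rows[of i vs j n ?row] assms by (simp add: encode_def nth_append)
  ultimately show ?thesis unfolding eq by (simp add: input_tape_def del: of_nat_add of_nat_Suc)
qed

lemma in_P_for_alpha: "in_P_for {G. cograph G} (unfrozenness alpha)"
proof -
  define M where "M x i j \<longleftrightarrow>
    snd (input_tape x) (int (ones x) + 1 + int i * int (max 1 (ones x)) + int j) = 2" for x i j
  obtain T where T: "polytime_tm T"
    "\<And>x. accepts T x \<longleftrightarrow> \<not> sem (max 1 (ones x)) (M x) frozen_loop (\<lambda>_. 0) (\<lambda>_ _. False) two 0"
    using decide_by_loop[OF wf_frozen_loop, of two, folded M_def] by auto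
  have "accepts T (encode vs G) \<longleftrightarrow> G \<in> unfrozenness alpha"
    if G: "cograph G" and vs: "distinct vs" "set vs = verts G" for G :: "nat ugraph" and vs
  proof -
    note simple = cograph_simple_graph[OF G]
    let ?n = "length vs" and ?M = "\<lambda>i j. adjacent G (vs ! i) (vs ! j)"
    \<comment> \<open>Co-graphs have a vertex, so the value \<open>n = 1\<close> that the startup
      would give to an empty graph does not occur.\<close>
    have "verts G \<noteq> {}" using G by (induction) (auto simp: graph_union_def graph_join_def)
    then have max1: "max 1 ?n = ?n" using vs by (cases vs) auto
    then have n: "max 1 (ones (encode vs G)) = ?n" by (simp only: encode_ones)
    have inj: "inj_on (nth vs) {..<?n}" using vs by (simp add: inj_on_def nth_eq_iff_index_eq)
    have img: "nth vs ` {..<?n} = verts G" using vs(2) by (auto simp: set_conv_nth)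
    have "M (encode vs G) i j = ?M i j" if "i < ?n" "j < ?n" for i j
      unfolding M_def encode_ones max1 by (rule encode_matrix[OF that])
    then have "sem ?n (M (encode vs G)) frozen_loop (\<lambda>_. 0) (\<lambda>_ _. False) =
        sem ?n ?M frozen_loop (\<lambda>_. 0) (\<lambda>_ _. False)"
      by (rule sem_cong) (use max1 in auto)
    moreover have "sem ?n ?M frozen_loop (\<lambda>_. 0) (\<lambda>_ _. False) two 0 \<longleftrightarrow> 2 \<le> card (core ?M {..<?n})"
    proof (rule sem_frozen_loop)
      show "symp ?M" "irreflp ?M" using simple_graph_adjacent[OF simple] by (auto simp: symp_def irreflp_def)
      fix H i j assume H: "H \<subseteq> {..<?n}" "i \<in> H" "j \<in> H" "?M i j"
      \<comment> \<open>The twin pair is found among vertices and pulled back to positions, on which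
        the loops work.\<close>
      then have "nth vs ` H \<subseteq> verts G" using img by blast
      then obtain u w where uw: "twin_pair (adjacent G) (nth vs ` H) u w"
        using cograph_twin_pair[OF G, of "nth vs ` H" "vs ! i" "vs ! j"] H by blast
      then obtain a b where ab: "a \<in> H" "b \<in> H" "u = vs ! a" "w = vs ! b" by (auto simp: twin_pair_def)
      have "twin_pair ?M H a b"
        by (rule twin_pair_image) (use uw ab in auto)
      then show "\<exists>a b. twin_pair ?M H a b" by blast
    qed simp
    moreover have "card (core ?M {..<?n}) = card (core (adjacent G) (verts G))"
    proof -
      have "core (adjacent G) (verts G) = nth vs ` core ?M {..<?n}"
        using core_image[OF inj, of "adjacent G"] by (simp only: img)
      moreover have "inj_on (nth vs) (core ?M {..<?n})"
        by (rule inj_on_subset[OF inj]) (auto simp: core_def)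
      ultimately show ?thesis by (simp add: card_image)
    qed
    ultimately have "accepts T (encode vs G) \<longleftrightarrow> card (core (adjacent G) (verts G)) \<le> 1"
      unfolding T(2) n by auto
    then show ?thesis using unfrozen_alpha_core[OF simple] simple by (simp add: unfrozenness_def)
  qed
  then show ?thesis using T(1) unfolding in_P_for_def by blast
qed

theorem corollary15:
  shows "in_P_for {G. cograph G} (unfrozenness beta) \<and>
         in_P_for {G. cograph G} (unfrozenness alpha)"
proof -
  have "G \<in> unfrozenness beta \<longleftrightarrow> G \<in> unfrozenness alpha" for G :: "nat ugraph"
    using unfrozen_beta_alpha[of G] by (auto simp: unfrozenness_def)
  then have "unfrozenness beta = (unfrozenness alpha :: nat ugraph set)" by blast
  then show ?thesis using in_P_for_alpha by simp
qed

end
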